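(* Let $X$ be a perfect Hausdorff uniform space. If $G$ is a subgroup of $\mathrm{Aut}(X)$, then $$\omega(X,G)=2-\mu(X,G),$$ where $\omega(X,G)$ is the asymptotic uniform complexity and $\mu(X,G)$ the mean topological matching number of $(X,G)$.
   Context: Set notation: $\mathcal{P}(X)$ is the power set of $X$, $\mathcal{F}(X)$ the set of finite subsets of $X$, and $\mathcal{F}_{+}(X)=\mathcal{F}(X)\setminus\{\emptyset\}$. For $\mathcal{U},\mathcal{V}\subseteq\mathcal{P}(X)$, write $\mathcal{U}\preceq\mathcal{V}$ ("$\mathcal{V}$ refines $\mathcal{U}$") if every $V\in\mathcal{V}$ is contained in some $U\in\mathcal{U}$; put $\mathcal{U}\vee\mathcal{V}=\{U\cap V\mid U\in\mathcal{U},V\in\mathcal{V}\}$. For $S\subseteq X$ put $\mathrm{St}(S,\mathcal{U})=\bigcup\{U\in\mathcal{U}\mid U\cap S\neq\emptyset\}$, $\mathrm{St}(x,\mathcal{U})=\mathrm{St}(\{x\},\mathcal{U})$, and $\mathcal{U}^{\ast}=\{\mathrm{St}(U,\mathcal{U})\mid U\in\mathcal{U}\}$; write $\mathcal{U}\preceq^{\ast}\mathcal{V}$ if $\mathcal{U}\preceq\mathcal{V}^{\ast}$. A covering of $X$ is a $\mathcal{U}\subseteq\mathcal{P}(X)$ with $\bigcup\mathcal{U}=X$. Uniform spaces (via coverings): a uniformity on $X$ is a non-empty set $\mathcal{D}$ of coverings of $X$ such that (1) if $\mathcal{U}\in\mathcal{D}$ and $\mathcal{V}$ is a covering of $X$ with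 $\mathcal{V}\preceq\mathcal{U}$, then $\mathcal{V}\in\mathcal{D}$; (2) for all $\mathcal{U},\mathcal{V}\in\mathcal{D}$ there is $\mathcal{W}\in\mathcal{D}$ with $\mathcal{U}\preceq^{\ast}\mathcal{W}$ and $\mathcal{V}\preceq^{\ast}\mathcal{W}$. A uniform space is a non-empty set $X$ with a uniformity, whose elements are called uniform coverings. $\mathcal{N}(X)$ is the set of finite uniform coverings of $X$. The topology of $X$: $S\subseteq X$ is open iff for every $x\in S$ there is a uniform covering $\mathcal{U}$ with $\mathrm{St}(x,\mathcal{U})\subseteq S$. "Perfect" means that this topology has no isolated points, and "Hausdorff" refers to this topology. A map $f\colon X\to Y$ of uniform spaces is uniformly continuous if $f^{-1}(\mathcal{U})=\{f^{-1}(U)\mid U\in\mathcal{U}\}$ is a uniform covering of $X$ for each uniform covering $\mathcal{U}$ of $Y$. $\mathrm{Aut}(X)$ is the group of bijections $X\to X$ that are uniformly continuous with uniformly continuous inverse. For $g\in\mathrm{Aut}(X)$, $g(\mathcal{V})=\{g(V)\mid V\in\mathcal{V}\}$. Uniform complexity: for $\mathcal{U}\in\mathcal{N}(X)$, $N(\mathcal{U})=\inf\{|\mathcal{V}|\mid\mathcal{V}\in\mathcal{N}(X),\ \mathcal{U}\preceq\mathcal{V}\}$. Asymptotic uniform complexity: $$\omega(X,G)=\sup_{E\in\mathcal{F}(G)}\ \sup_{\mathcal{U}\in\mathcal{N}(X)}\ \inf\left\{\sup_{g\in E}\frac{N(\mathcal{V}\vee g(\mathcal{V}))}{N(\mathcal{V})}\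 \middle|\ \mathcal{V}\in\mathcal{N}(X),\ \mathcal{U}\preceq\mathcal{V}\right\}.$$ Mean topological matching number: for $E,F\in\mathcal{F}(X)$ and $\mathcal{U}\subseteq\mathcal{P}(X)$, $\mu(E,F,\mathcal{U})$ is the maximum of $|D|$ over all injective maps $\phi\colon D\to F$ with $D\subseteq E$ such that for each $x\in D$ there is $U\in\mathcal{U}$ with $\{x,\phi(x)\}\subseteq U$. Then $$\mu(X,G)=\inf_{E\in\mathcal{F}(G)}\ \inf_{\mathcal{U}\in\mathcal{N}(X)}\ \sup_{F\in\mathcal{F}_{+}(X)}\ \inf_{g\in E}\frac{\mu(F,g(F),\mathcal{U})}{|F|}\in[0,1].$$ (Empty suprema/infima are taken in the extended reals; $E=\emptyset$ does not affect these quantities.) *)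

theory Defs
  imports "HOL-Analysis.Analysis" "HOL-Algebra.Bij"
begin

definition refined_by :: "'a set set \<Rightarrow> 'a set set \<Rightarrow> bool"  (infix \<open>\<preceq>\<close> 50) where
  "\<U> \<preceq> \<V> \<longleftrightarrow> (\<forall>V\<in>\<V>. \<exists>U\<in>\<U>. V \<subseteq> U)"

definition cover_join :: "'a set set \<Rightarrow> 'a set set \<Rightarrow> 'a set set"  (infixl \<open>\<or>\<^sub>c\<close> 65) where
  "\<U> \<or>\<^sub>c \<V> = {U \<inter> V |U V. U \<in> \<U> \<and> V \<in> \<V>}"

definition cover_star :: "'a set \<Rightarrow> 'a set set \<Rightarrow> 'a set" where
  "cover_star S \<U> = \<Union>{U \<in> \<U>. U \<inter> S \<noteq> {}}"

definition star_cover :: "'a set set \<Rightarrow> 'a set set" where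
  "star_cover \<U> = {cover_star U \<U> |U. U \<in> \<U>}"

definition star_refined_by :: "'a set set \<Rightarrow> 'a set set \<Rightarrow> bool"  (infix \<open>\<preceq>\<^sup>*\<close> 50) where
  "\<U> \<preceq>\<^sup>* \<V> \<longleftrightarrow> \<U> \<preceq> star_cover \<V>"

definition covering_of :: "'a set \<Rightarrow> 'a set set \<Rightarrow> bool" where
  "covering_of X \<U> \<longleftrightarrow> \<U> \<subseteq> Pow X \<and> \<Union>\<U> = X"

definition uniformity_on :: "'a set \<Rightarrow> 'a set set set \<Rightarrow> bool" where
  "uniformity_on X \<D> \<longleftrightarrow>
     \<D> \<noteq> {} \<and> (\<forall>\<U>\<in>\<D>. covering_of X \<U>) \<and>
     (\<forall>\<U>\<in>\<D>. \<forall>\<V>. covering_of X \<V> \<and> \<V> \<preceq> \<U> \<longrightarrow> \<V> \<in> \<D>) \<and>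
     (\<forall>\<U>\<in>\<D>. \<forall>\<V>\<in>\<D>. \<exists>\<W>\<in>\<D>. \<U> \<preceq>\<^sup>* \<W> \<and> \<V> \<preceq>\<^sup>* \<W>)"

definition covering_uniform_space :: "'a set \<Rightarrow> 'a set set set \<Rightarrow> bool" where
  "covering_uniform_space X \<D> \<longleftrightarrow> X \<noteq> {} \<and> uniformity_on X \<D>"

definition finite_uniform_coverings :: "'a set set set \<Rightarrow> 'a set set set" where
  "finite_uniform_coverings \<D> = {\<U> \<in> \<D>. finite \<U>}"

definition uniform_topology :: "'a set \<Rightarrow> 'a set set set \<Rightarrow> 'a topology" where
  "uniform_topology X \<D> =
     topology (\<lambda>S. S \<subseteq> X \<and> (\<forall>x\<in>S. \<exists>\<U>\<in>\<D>. cover_star {x} \<U> \<subseteq> S))"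

definition no_isolated_points :: "'a topology \<Rightarrow> bool" where
  "no_isolated_points T \<longleftrightarrow> (\<forall>x\<in>topspace T. \<not> openin T {x})"

definition uniform_continuous_map ::
  "'a set \<Rightarrow> 'a set set set \<Rightarrow> 'b set \<Rightarrow> 'b set set set \<Rightarrow> ('a \<Rightarrow> 'b) \<Rightarrow> bool" where
  "uniform_continuous_map X \<D> Y \<E> f \<longleftrightarrow>
     f \<in> X \<rightarrow> Y \<and> (\<forall>\<U>\<in>\<E>. {f -` U \<inter> X |U. U \<in> \<U>} \<in> \<D>)"

text \<open>
  As in \<^const>\<open>BijGroup\<close>, elements are extensional functions, so that each self-map of
  \<open>X\<close> has exactly one representative.
\<close>

definition uniform_Aut :: "'a set \<Rightarrow> 'a set set set \<Rightarrow> ('a \<Rightarrow> 'a) monoid" where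
  "uniform_Aut X \<D> = (BijGroup X)
     \<lparr>carrier := {g \<in> Bij X. uniform_continuous_map X \<D> X \<D> g \<and>
                            uniform_continuous_map X \<D> X \<D> (inv_into X g)}\<rparr>"

text \<open>
  The natural-number infimum is over a nonempty set when \<open>\<U>\<close> is a finite uniform covering.
\<close>

definition uniform_complexity :: "'a set set set \<Rightarrow> 'a set set \<Rightarrow> nat" where
  "uniform_complexity \<D> \<U> =
     (INF \<V>\<in>{\<V> \<in> finite_uniform_coverings \<D>. \<U> \<preceq> \<V>}. card \<V>)"

definition asymptotic_uniform_complexity :: "'a set set set \<Rightarrow> ('a \<Rightarrow> 'a) set \<Rightarrow> ereal" where
  "asymptotic_uniform_complexity \<D> G =
     (SUP E\<in>Fpow G. SUP \<U>\<in>finite_uniform_coverings \<D>.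
        INF \<V>\<in>{\<V> \<in> finite_uniform_coverings \<D>. \<U> \<preceq> \<V>}.
          SUP g\<in>E. ereal (real (uniform_complexity \<D> (\<V> \<or>\<^sub>c (`) g ` \<V>))
                          / real (uniform_complexity \<D> \<V>)))"

definition matching_number :: "'a set \<Rightarrow> 'a set \<Rightarrow> 'a set set \<Rightarrow> nat" where
  "matching_number E F \<U> =
     Max {card D |D. D \<subseteq> E \<and>
       (\<exists>\<phi>. inj_on \<phi> D \<and> \<phi> \<in> D \<rightarrow> F \<and> (\<forall>x\<in>D. \<exists>U\<in>\<U>. {x, \<phi> x} \<subseteq> U))}"

definition mean_matching_number ::
  "'a set \<Rightarrow> 'a set set set \<Rightarrow> ('a \<Rightarrow> 'a) set \<Rightarrow> ereal" where
  "mean_matching_number X \<D> G =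
     (INF E\<in>Fpow G. INF \<U>\<in>finite_uniform_coverings \<D>.
        SUP F\<in>Fpow X - {{}}.
          INF g\<in>E. ereal (real (matching_number F (g ` F) \<U>) / real (card F)))"

text \<open>
  The operator \<^const>\<open>topology\<close> is meaningful only for families closed under unions and
  finite intersections, and \<^const>\<open>uniform_Aut\<close> only overrides a carrier, so both
  definitions are justified here.
\<close>

lemma refined_by_star: "\<U> \<preceq>\<^sup>* \<W> \<Longrightarrow> \<U> \<preceq> \<W>"
  unfolding star_refined_by_def refined_by_def star_cover_def
proof
  fix V assume *: "\<forall>V\<in>{cover_star U \<W> |U. U \<in> \<W>}. \<exists>U\<in>\<U>. V \<subseteq> U" and V: "V \<in> \<W>"
  have "V \<subseteq> cover_star V \<W>" using V by (auto simp: cover_star_def)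
  moreover obtain U where "U \<in> \<U>" "cover_star V \<W> \<subseteq> U" using * V by blast
  ultimately show "\<exists>U\<in>\<U>. V \<subseteq> U" by blast
qed

lemma cover_star_mono:
  assumes "\<U> \<preceq> \<W>" shows "cover_star S \<W> \<subseteq> cover_star S \<U>"
proof
  fix y assume "y \<in> cover_star S \<W>"
  then obtain W where W: "W \<in> \<W>" "W \<inter> S \<noteq> {}" "y \<in> W" by (auto simp: cover_star_def)
  then obtain U where "U \<in> \<U>" "W \<subseteq> U" using assms by (auto simp: refined_by_def)
  with W show "y \<in> cover_star S \<U>" by (auto simp: cover_star_def)
qed

lemma openin_uniform_topology:
  assumes "uniformity_on X \<D>"
  shows "openin (uniform_topology X \<D>) S \<longleftrightarrow>
    S \<subseteq> X \<and> (\<forall>x\<in>S. \<exists>\<U>\<in>\<D>. cover_star {x} \<U> \<subseteq> S)"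
proof -
  have "istopology (\<lambda>S. S \<subseteq> X \<and> (\<forall>x\<in>S. \<exists>\<U>\<in>\<D>. cover_star {x} \<U> \<subseteq> S))"
    (is "istopology ?L")
    unfolding istopology_def
  proof (intro conjI allI impI)
    fix S T assume S: "?L S" and T: "?L T"
    have "\<exists>\<W>\<in>\<D>. cover_star {x} \<W> \<subseteq> S \<inter> T" if x: "x \<in> S \<inter> T" for x
    proof -
      obtain \<U> \<V> where uv: "\<U> \<in> \<D>" "cover_star {x} \<U> \<subseteq> S" "\<V> \<in> \<D>" "cover_star {x} \<V> \<subseteq> T"
        using S T x by blast
      then obtain \<W> where "\<W> \<in> \<D>" "\<U> \<preceq>\<^sup>* \<W>" "\<V> \<preceq>\<^sup>* \<W>"
        using assms unfolding uniformity_on_def by blast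
      then show ?thesis
        using uv cover_star_mono[OF refined_by_star] by (metis Int_greatest order_trans)
    qed
    then show "\<forall>x\<in>S \<inter> T. \<exists>\<U>\<in>\<D>. cover_star {x} \<U> \<subseteq> S \<inter> T" by blast
    show "S \<inter> T \<subseteq> X" using S by blast
  next
    fix \<K> assume K: "\<forall>K\<in>\<K>. ?L K"
    then show "\<Union>\<K> \<subseteq> X" by blast
    show "\<forall>x\<in>\<Union>\<K>. \<exists>\<U>\<in>\<D>. cover_star {x} \<U> \<subseteq> \<Union>\<K>"
      using K by (meson UnionE Union_upper order_trans)
  qed
  then show ?thesis by (simp add: uniform_topology_def)
qed

lemma topspace_uniform_topology:
  assumes "uniformity_on X \<D>"
  shows "topspace (uniform_topology X \<D>) = X"
proof -
  obtain \<U> where U: "\<U> \<in> \<D>" "covering_of X \<U>"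
    using assms unfolding uniformity_on_def by blast
  then have "cover_star {x} \<U> \<subseteq> X" for x
    by (auto simp: cover_star_def covering_of_def)
  then have "openin (uniform_topology X \<D>) X"
    using U by (auto simp: openin_uniform_topology[OF assms])
  moreover have "topspace (uniform_topology X \<D>) \<subseteq> X"
    using openin_uniform_topology[OF assms, of "topspace (uniform_topology X \<D>)"] by simp
  ultimately show ?thesis by (simp add: openin_subset subset_antisym)
qed

lemma uniform_continuous_map_cong:
  assumes "\<And>x. x \<in> X \<Longrightarrow> f x = g x"
  shows "uniform_continuous_map X \<D> Y \<E> f \<longleftrightarrow> uniform_continuous_map X \<D> Y \<E> g"
proof -
  have "f -` U \<inter> X = g -` U \<inter> X" for U using assms by auto
  then show ?thesis using assms by (auto simp: uniform_continuous_map_def Pi_iff)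
qed

lemma uniform_continuous_map_comp:
  assumes f: "uniform_continuous_map X \<D> Y \<E> f" and g: "uniform_continuous_map Y \<E> Z \<F> g"
  shows "uniform_continuous_map X \<D> Z \<F> (g \<circ> f)"
proof -
  have "{(g \<circ> f) -` U \<inter> X |U. U \<in> \<U>} \<in> \<D>" if "\<U> \<in> \<F>" for \<U>
  proof -
    have "{g -` U \<inter> Y |U. U \<in> \<U>} \<in> \<E>"
      using g that by (auto simp: uniform_continuous_map_def)
    then have "{f -` V \<inter> X |V. V \<in> {g -` U \<inter> Y |U. U \<in> \<U>}} \<in> \<D>"
      using f by (auto simp: uniform_continuous_map_def)
    moreover have "f -` (g -` U \<inter> Y) \<inter> X = (g \<circ> f) -` U \<inter> X" for U
      using f by (auto simp: uniform_continuous_map_def)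
    then have "{f -` V \<inter> X |V. V \<in> {g -` U \<inter> Y |U. U \<in> \<U>}} = {(g \<circ> f) -` U \<inter> X |U. U \<in> \<U>}"
      by (smt (verit) Collect_cong mem_Collect_eq)
    ultimately show ?thesis by simp
  qed
  then show ?thesis using f g by (auto simp: uniform_continuous_map_def)
qed

lemma uniform_continuous_map_id:
  assumes "uniformity_on X \<D>"
  shows "uniform_continuous_map X \<D> X \<D> (\<lambda>x. x)"
proof -
  have "{(\<lambda>x. x) -` U \<inter> X |U. U \<in> \<U>} = \<U>" if "\<U> \<in> \<D>" for \<U>
  proof -
    have "\<And>U. U \<in> \<U> \<Longrightarrow> U \<inter> X = U"
      using assms that by (auto simp: uniformity_on_def covering_of_def)
    then show ?thesis by (force simp: vimage_def)
  qed
  then show ?thesis by (auto simp: uniform_continuous_map_def)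
qed

lemma subgroup_uniform_Aut:
  assumes "uniformity_on X \<D>"
  shows "subgroup (carrier (uniform_Aut X \<D>)) (BijGroup X)"
proof -
  interpret group "BijGroup X" by (rule group_BijGroup)
  let ?u = "uniform_continuous_map X \<D> X \<D>"
  have inv_id: "inv_into X (\<lambda>x\<in>X. x) x = x" if "x \<in> X" for x
    using that by (intro inv_into_f_eq) (auto simp: inj_on_def)
  have inv: "inv_into X (\<lambda>x\<in>X. inv_into X g x) x = g x" if "g \<in> Bij X" "x \<in> X" for g x
  proof -
    have b: "bij_betw g X X" "bij_betw (\<lambda>x\<in>X. inv_into X g x) X X"
      using that restrict_inv_into_Bij by (auto simp: Bij_def)
    have "(\<lambda>x\<in>X. inv_into X g x) (g x) = x" "g x \<in> X"
      using b that by (auto simp: bij_betw_inv_into_left bij_betwE)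
    then show ?thesis using inv_into_f_eq[OF bij_betw_imp_inj_on[OF b(2)]] by blast
  qed
  have comp: "inv_into X (compose X g h) x = inv_into X h (inv_into X g x)"
    if "g \<in> Bij X" "h \<in> Bij X" "x \<in> X" for g h x
  proof -
    have b: "bij_betw g X X" "bij_betw h X X" "bij_betw (compose X g h) X X"
      using that compose_Bij by (auto simp: Bij_def)
    let ?y = "inv_into X h (inv_into X g x)"
    have i: "inv_into X g x \<in> X" "?y \<in> X"
      using that by (simp_all add: Bij_inv_into_mem)
    then have "compose X g h ?y = x"
      using b that by (simp add: compose_def bij_betw_inv_into_right)
    then show ?thesis using inv_into_f_eq[OF bij_betw_imp_inj_on[OF b(3)] i(2)] by blast
  qed
  show ?thesis
  proof (rule subgroupI)
    show "carrier (uniform_Aut X \<D>) \<subseteq> carrier (BijGroup X)"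
      by (auto simp: uniform_Aut_def BijGroup_def)
    have "?u (\<lambda>x\<in>X. x)" "?u (inv_into X (\<lambda>x\<in>X. x))"
      using uniform_continuous_map_id[OF assms] inv_id
        uniform_continuous_map_cong[of X "\<lambda>x\<in>X. x" "\<lambda>x. x"]
        uniform_continuous_map_cong[of X "inv_into X (\<lambda>x\<in>X. x)" "\<lambda>x. x"]
      by auto
    then show "carrier (uniform_Aut X \<D>) \<noteq> {}"
      using id_Bij by (auto simp: uniform_Aut_def)
  next
    fix g assume "g \<in> carrier (uniform_Aut X \<D>)"
    then have g: "g \<in> Bij X" "?u g" "?u (inv_into X g)" by (auto simp: uniform_Aut_def)
    let ?i = "\<lambda>x\<in>X. inv_into X g x"
    have "?u ?i" "?u (inv_into X ?i)"
      using g(3) uniform_continuous_map_cong[of X ?i "inv_into X g"]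
            g(2) uniform_continuous_map_cong[of X "inv_into X ?i" g] inv[OF g(1)] by auto
    then show "inv\<^bsub>BijGroup X\<^esub> g \<in> carrier (uniform_Aut X \<D>)"
      using g(1) by (simp add: inv_BijGroup restrict_inv_into_Bij uniform_Aut_def)
  next
    fix g h assume "g \<in> carrier (uniform_Aut X \<D>)" "h \<in> carrier (uniform_Aut X \<D>)"
    then have g: "g \<in> Bij X" "?u g" "?u (inv_into X g)" and h: "h \<in> Bij X" "?u h" "?u (inv_into X h)"
      by (auto simp: uniform_Aut_def)
    have "?u (compose X g h)"
      using uniform_continuous_map_comp[OF h(2) g(2)]
        uniform_continuous_map_cong[of X "compose X g h" "g \<circ> h"] by (simp add: compose_def)
    moreover have "?u (inv_into X (compose X g h))"
      using uniform_continuous_map_comp[OF g(3) h(3)] comp[OF g(1) h(1)]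
        uniform_continuous_map_cong[of X "inv_into X (compose X g h)" "inv_into X h \<circ> inv_into X g"]
      by simp
    ultimately show "g \<otimes>\<^bsub>BijGroup X\<^esub> h \<in> carrier (uniform_Aut X \<D>)"
      using g(1) h(1) by (simp add: BijGroup_def compose_Bij uniform_Aut_def)
  qed
qed

lemma group_uniform_Aut:
  assumes "uniformity_on X \<D>"
  shows "group (uniform_Aut X \<D>)"
proof -
  have "uniform_Aut X \<D> = (BijGroup X)\<lparr>carrier := carrier (uniform_Aut X \<D>)\<rparr>"
    by (simp add: uniform_Aut_def)
  then show ?thesis
    using subgroup.subgroup_is_group[OF subgroup_uniform_Aut[OF assms] group_BijGroup] by simp
qed

end

theory Submission
  imports Defs
begin

text \<open>
  Both inequalities compare coverings with finite point sets. Fix a finite set \<open>E\<close> of automorphisms;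
  nearness of two points always means that they lie in a common member of some fine finite
  uniform covering.

  \<^emph>\<open>Coverings give matchings\<close> (\<open>matching_from_coverings\<close>). Let \<open>\<V>\<close> be fine, and let \<open>\<V>\<^sub>0\<close> and \<open>\<Z>\<close> be
  cheapest finite refinements of \<open>\<V>\<close> and of \<open>\<V> \<or>\<^sub>c g(\<V>)\<close>, with \<open>n = N(\<V>)\<close> and \<open>N(\<V> \<or>\<^sub>c g(\<V>))\<close> members.
  Some members of \<open>\<V>\<^sub>0\<close> may be exchanged for the members of \<open>\<Z>\<close> that meet them, so by minimality
  at least \<open>card S\<close> members of \<open>\<Z>\<close> meet the union of a subfamily \<open>S\<close> of \<open>\<V>\<^sub>0\<close>; the same holds for
  subfamilies of \<open>g(\<V>\<^sub>0)\<close>. Join a member of \<open>\<V>\<^sub>0\<close> to a member of \<open>g(\<V>\<^sub>0)\<close> if some member of \<open>\<Z>\<close> meets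
  both. A subfamily \<open>S\<close> and the members of \<open>g(\<V>\<^sub>0)\<close> not joined to it use up disjoint parts of \<open>\<Z>\<close>,
  whence Hall's condition holds with deficiency \<open>card \<Z> - n\<close>, and there is a matching of size at
  least \<open>2n - card \<Z>\<close>. Choosing distinct points in the members of \<open>\<V>\<^sub>0\<close>, which are infinite because
  the space is perfect, turns it into a matching of points, for all \<open>g \<in> E\<close> with the same point set.

  \<^emph>\<open>Matchings give coverings\<close> (\<open>covering_from_matchings\<close>). Given \<open>F\<close> with large matchings, a covering
  \<open>\<V>\<close> is built in which every point \<open>x\<close> of \<open>F\<close> has a member of its own, namely a neighbourhood of \<open>x\<close>
  of uniform size from which the other points of \<open>F\<close> are removed; a bounded number of further members
  covers the rest. Then \<open>N(\<V>) \<ge> card F\<close>. If \<open>x\<close> and \<open>g y\<close> are matched, the members at \<open>x\<close> and (moved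
  by \<open>g\<close>) at \<open>y\<close> intersect in a common neighbourhood of both points, which saves one set in a refinement
  of \<open>\<V> \<or>\<^sub>c g(\<V>)\<close>: roughly \<open>2 card F\<close> minus the size of the matching many sets suffice. Two points need care.
  The bounded number of further members must be negligible, so first \<open>F\<close> is blown up, each point being
  replaced by many nearby points (\<open>blow_up_matching\<close>), which is possible in a perfect space. And a point
  of \<open>F \<inter> g(F)\<close> can only be matched with itself, since elsewhere it has been removed from
  the sets of the covering; matchings are adapted to this with an arbitrarily small loss,
  at the price of iterating the nearness relation a bounded number of times (\<open>off_diagonal_matching\<close>).
\<close>

section \<open>Matchings in finite bipartite graphs\<close>

text \<open>
  The argument of Halmos and Vaughan: if some nonempty proper subset \<open>S\<close> of \<open>A\<close> is tight, then \<open>S\<close> and its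
  complement can be matched independently; otherwise any first choice leaves Hall's condition intact.
\<close>

theorem hall_marriage:
  fixes r :: "'i \<Rightarrow> 'b set"
  assumes "finite A" "\<And>a. a \<in> A \<Longrightarrow> finite (r a)"
    and "\<And>S. S \<subseteq> A \<Longrightarrow> card S \<le> card (\<Union>(r ` S))"
  shows "\<exists>f. inj_on f A \<and> (\<forall>a\<in>A. f a \<in> r a)"
  using assms
proof (induction "card A" arbitrary: A r rule: less_induct)
  case less
  note fin = less.prems(1) and finr = less.prems(2) and hall = less.prems(3)
  show ?case
  proof (cases "A = {}")
    case True
    then show ?thesis by simp
  next
    case ne: False
    show ?thesis
    proof (cases "\<exists>S. S \<subset> A \<and> S \<noteq> {} \<and> card (\<Union>(r ` S)) \<le> card S")
      case True
      then obtain S where S: "S \<subset> A" "S \<noteq> {}" "card (\<Union>(r ` S)) \<le> card S" by blast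
      let ?U = "\<Union>(r ` S)"
      have finS: "finite S" using S fin finite_subset by blast
      have finU: "finite ?U" using finS S finr by auto
      have "\<exists>f. inj_on f S \<and> (\<forall>a\<in>S. f a \<in> r a)"
      proof (rule less.hyps)
        show "card S < card A" using S fin psubset_card_mono by blast
        show "finite S" by fact
        show "\<And>a. a \<in> S \<Longrightarrow> finite (r a)" using S finr by blast
        show "\<And>T. T \<subseteq> S \<Longrightarrow> card T \<le> card (\<Union>(r ` T))" using S hall by blast
      qed
      then obtain f where f: "inj_on f S" "\<forall>a\<in>S. f a \<in> r a" by blast
      have "\<exists>f. inj_on f (A - S) \<and> (\<forall>a\<in>A - S. f a \<in> r a - ?U)"
      proof (rule less.hyps)
        show "card (A - S) < card A" using S fin by (metis Diff_subset card_seteq not_le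
              Diff_eq_empty_iff Diff_disjoint Int_absorb1 psubsetE double_diff order_refl)
        show "finite (A - S)" using fin by simp
        show "\<And>a. a \<in> A - S \<Longrightarrow> finite (r a - ?U)" using finr by blast
      next
        fix T assume T: "T \<subseteq> A - S"
        have finT: "finite T" using T fin finite_subset by blast
        have "card T + card S = card (T \<union> S)"
          using T finT finS by (subst card_Un_disjoint) auto
        also have "\<dots> \<le> card (\<Union>(r ` (T \<union> S)))" using hall[of "T \<union> S"] T S by blast
        also have "\<Union>(r ` (T \<union> S)) = \<Union>((\<lambda>a. r a - ?U) ` T) \<union> ?U" by auto
        also have "card \<dots> \<le> card (\<Union>((\<lambda>a. r a - ?U) ` T)) + card ?U" by (rule card_Un_le)
        finally show "card T \<le> card (\<Union>((\<lambda>a. r a - ?U) ` T))" using S(3) by linarith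
      qed
      then obtain f' where f': "inj_on f' (A - S)" "\<forall>a\<in>A - S. f' a \<in> r a - ?U" by blast
      let ?h = "\<lambda>a. if a \<in> S then f a else f' a"
      have ne: "f b \<noteq> f' a" if "b \<in> S" "a \<in> A - S" for a b
      proof
        assume "f b = f' a"
        moreover have "f b \<in> ?U" using f(2) that(1) by blast
        moreover have "f' a \<notin> ?U" using f'(2) that(2) by blast
        ultimately show False by simp
      qed
      have "inj_on ?h A"
      proof (rule inj_onI)
        fix a b assume ab: "a \<in> A" "b \<in> A" "?h a = ?h b"
        consider "a \<in> S" "b \<in> S" | "a \<in> A - S" "b \<in> A - S" | "a \<in> S" "b \<in> A - S"
          | "a \<in> A - S" "b \<in> S" using ab by blast
        then show "a = b"
        proof cases
          case 1 then show ?thesis using ab f(1) by (simp add: inj_on_eq_iff)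
        next
          case 2 then show ?thesis using ab f'(1) by (simp add: inj_on_eq_iff)
        next
          case 3 then show ?thesis using ab ne[of a b] by simp
        next
          case 4 then show ?thesis using ab ne[of b a] by simp
        qed
      qed
      moreover have "\<forall>a\<in>A. ?h a \<in> r a" using f f' by auto
      ultimately show ?thesis by blast
    next
      case False
      obtain a where a: "a \<in> A" using ne by blast
      have "card {a} \<le> card (r a)" using hall[of "{a}"] a by simp
      then obtain b where b: "b \<in> r a" by fastforce
      have "\<exists>f. inj_on f (A - {a}) \<and> (\<forall>x\<in>A - {a}. f x \<in> r x - {b})"
      proof (rule less.hyps)
        show "card (A - {a}) < card A" using a fin by (meson card_Diff1_less)
        show "finite (A - {a})" using fin by simp
        show "\<And>x. x \<in> A - {a} \<Longrightarrow> finite (r x - {b})" using finr by blast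
      next
        fix T assume T: "T \<subseteq> A - {a}"
        show "card T \<le> card (\<Union>((\<lambda>x. r x - {b}) ` T))"
        proof (cases "T = {}")
          case True
          then show ?thesis by simp
        next
          case False
          have "T \<subset> A" using T a by blast
          then have lt: "card T < card (\<Union>(r ` T))"
            using False \<open>\<not> (\<exists>S. S \<subset> A \<and> S \<noteq> {} \<and> card (\<Union>(r ` S)) \<le> card S)\<close>
            by (metis not_le)
          have U: "\<Union>((\<lambda>x. r x - {b}) ` T) = \<Union>(r ` T) - {b}" by auto
          have "card (\<Union>(r ` T)) - 1 \<le> card (\<Union>(r ` T) - {b})"
            using card_Diff_singleton_if[of "\<Union>(r ` T)" b] by (simp split: if_splits)
          then show ?thesis unfolding U using lt by linarith
        qed
      qed
      then obtain f where f: "inj_on f (A - {a})" "\<forall>x\<in>A - {a}. f x \<in> r x - {b}" by blast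
      have "inj_on (f(a := b)) (insert a (A - {a}))"
        unfolding inj_on_insert using f by (auto simp: inj_on_def)
      then have "inj_on (f(a := b)) A" using a by (simp add: insert_absorb)
      moreover have "\<forall>x\<in>A. (f(a := b)) x \<in> r x" using f b by auto
      ultimately show ?thesis by blast
    qed
  qed
qed

text \<open>
  Hall's theorem applies after \<open>d\<close> extra right-hand vertices, adjacent to everything, have been
  added; at most \<open>d\<close> of the left-hand vertices are then matched with an extra vertex.
\<close>

theorem hall_deficiency:
  fixes r :: "'i \<Rightarrow> 'b set"
  assumes fin: "finite A" and finr: "\<And>a. a \<in> A \<Longrightarrow> finite (r a)"
    and hall: "\<And>S. S \<subseteq> A \<Longrightarrow> card S \<le> card (\<Union>(r ` S)) + d"
  obtains D f where "D \<subseteq> A" "inj_on f D" "\<And>a. a \<in> D \<Longrightarrow> f a \<in> r a" "card A \<le> card D + d"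
proof -
  let ?r = "\<lambda>a. Inl ` r a \<union> Inr ` {..<d} :: ('b + nat) set"
  have "\<exists>f. inj_on f A \<and> (\<forall>a\<in>A. f a \<in> ?r a)"
  proof (rule hall_marriage)
    fix S assume S: "S \<subseteq> A"
    show "card S \<le> card (\<Union>(?r ` S))"
    proof (cases "S = {}")
      case False
      have finU: "finite (\<Union>(r ` S))" using S fin finr by (meson finite_UN_I finite_subset subsetD)
      have U: "\<Union>(?r ` S) = Inl ` (\<Union>(r ` S)) \<union> Inr ` {..<d}" using False by auto
      have "card (\<Union>(?r ` S)) = card (\<Union>(r ` S)) + d"
        unfolding U using finU by (subst card_Un_disjoint) (auto simp: card_image)
      then show ?thesis using hall[OF S] by simp
    qed simp
  qed (use fin finr in auto)
  then obtain f where f: "inj_on f A" "\<forall>a\<in>A. f a \<in> ?r a" by blast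
  define D where "D = {a \<in> A. f a \<in> Inl ` r a}"
  have "f ` (A - D) \<subseteq> Inr ` {..<d}" using f by (auto simp: D_def)
  then have "card (f ` (A - D)) \<le> card (Inr ` {..<d} :: ('b + nat) set)"
    by (intro card_mono) auto
  moreover have "card (f ` (A - D)) = card (A - D)"
    using f by (intro card_image) (auto simp: inj_on_def)
  moreover have "card (Inr ` {..<d} :: ('b + nat) set) = d" by (simp add: card_image)
  moreover have "card A = card D + card (A - D)"
    using fin by (subst card_Un_disjoint[symmetric]) (auto simp: D_def intro: arg_cong[of _ _ card])
  ultimately have c: "card A \<le> card D + d" by linarith
  have D: "f a = Inl (projl (f a))" "projl (f a) \<in> r a" "a \<in> A" if "a \<in> D" for a
    using that by (auto simp: D_def)
  show thesis
  proof (rule that)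
    show "D \<subseteq> A" by (auto simp: D_def)
    show "inj_on (\<lambda>a. projl (f a)) D"
    proof (rule inj_onI)
      fix a b assume ab: "a \<in> D" "b \<in> D" "projl (f a) = projl (f b)"
      then have "f a = f b" using D(1)[of a] D(1)[of b] by simp
      then show "a = b" using f(1) D(3) ab by (simp add: inj_on_eq_iff)
    qed
  qed (use D c in auto)
qed

text \<open>Perfectness is used in this form: infinite neighbourhoods have distinct representatives even if they overlap.\<close>

lemma distinct_representatives_of_infinite_sets:
  assumes "finite I" "\<And>i. i \<in> I \<Longrightarrow> infinite (S i)"
  shows "\<exists>h. inj_on h I \<and> (\<forall>i\<in>I. h i \<in> S i)"
  using assms
proof (induction I)
  case (insert i I)
  then obtain h where h: "inj_on h I" "\<forall>i\<in>I. h i \<in> S i" by auto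
  have "infinite (S i - h ` I)" using insert by (simp add: Diff_infinite_finite)
  then obtain s where s: "s \<in> S i" "s \<notin> h ` I" by (meson Diff_iff finite.emptyI finite_subset subsetI)
  have "inj_on (h(i := s)) (insert i I)" using h s insert.hyps by (auto simp: inj_on_def)
  moreover have "\<forall>j\<in>insert i I. (h(i := s)) j \<in> S j" using h s by auto
  ultimately show ?case by blast
qed simp

text \<open>
  In a matching of \<open>A\<close> with \<open>B\<close>, points of \<open>A \<inter> B\<close> may be matched with points other than themselves.
  The matching \<open>\<psi>\<close> avoids \<open>A \<inter> B\<close> altogether, so that together with the identity on \<open>A \<inter> B\<close> it is again
  a matching, smaller than \<open>\<phi>\<close> by at most \<open>card A div K\<close>. The price is that \<open>R\<close> is iterated up to \<open>K\<close> times.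

  Hall's condition holds for the following reason. For \<open>S \<subseteq> A - B\<close>, let \<open>T i\<close> consist of \<open>S\<close> and the points of \<open>A \<inter> B\<close> reachable from
  \<open>S\<close> inside \<open>A \<inter> B\<close> in at most \<open>i\<close> steps. Up to the deficiency of \<open>\<phi>\<close>, the
  \<open>R\<close>-neighbours of \<open>T i\<close> in \<open>B\<close> are at least as many as the points of \<open>T i\<close>, and those in \<open>A\<close> belong to
  \<open>T (Suc i) - S\<close>.
  So if \<open>T (Suc i)\<close> is hardly larger than \<open>T i\<close>, then nearly \<open>card S\<close> of them lie outside \<open>A\<close>.
\<close>

lemma off_diagonal_matching:
  fixes R :: "('b \<times> 'b) set"
  assumes fin: "finite A" "finite B" and D: "D \<subseteq> A" "inj_on \<phi> D" "\<phi> ` D \<subseteq> B"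
    and near: "\<And>x. x \<in> D \<Longrightarrow> (x, \<phi> x) \<in> R"
    and refl: "\<And>x. x \<in> A \<Longrightarrow> (x, x) \<in> R" and K: "0 < K"
  obtains D' \<psi> where "D' \<subseteq> A - B" "inj_on \<psi> D'" "\<psi> ` D' \<subseteq> B - A"
    "\<And>x. x \<in> D' \<Longrightarrow> \<exists>k<K. (x, \<psi> x) \<in> R ^^ Suc k"
    "card D \<le> card D' + card (A \<inter> B) + card A div K"
proof -
  let ?r = "\<lambda>x. {y \<in> B - A. \<exists>k<K. (x, y) \<in> R ^^ Suc k}"
  define d where "d = card A - card D + card A div K"
  have finD: "finite D" "card D \<le> card A" using D fin by (auto intro: finite_subset card_mono)
  have "card S \<le> card (\<Union>(?r ` S)) + d" if S: "S \<subseteq> A - B" for S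
  proof -
    define T where "T = rec_nat S (\<lambda>_ Q. S \<union> (R `` Q \<inter> (A \<inter> B)))"
    have T0: "T 0 = S" and TS: "T (Suc i) = S \<union> (R `` T i \<inter> (A \<inter> B))" for i
      by (simp_all add: T_def)
    have TA: "T i \<subseteq> A" for i by (cases i) (use S T0 TS in auto)
    have finT: "finite (T i)" for i using TA fin finite_subset by blast
    have ST: "S \<subseteq> T i" for i by (cases i) (use T0 TS in auto)
    have mono: "T i \<subseteq> T (Suc i)" for i
    proof
      fix x assume x: "x \<in> T i"
      then have "x \<in> S \<or> x \<in> A \<inter> B" by (cases i) (use T0 TS in auto)
      then show "x \<in> T (Suc i)" using x TA refl TS by blast
    qed
    have reach: "\<exists>s\<in>S. \<exists>k\<le>i. (s, x) \<in> R ^^ k" if "x \<in> T i" for x i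
      using that
    proof (induction i arbitrary: x)
      case 0
      then show ?case using T0 by auto
    next
      case (Suc i)
      show ?case
      proof (cases "x \<in> S")
        case True
        then show ?thesis by (intro bexI[of _ x] exI[of _ 0]) auto
      next
        case False
        then obtain y where y: "y \<in> T i" "(y, x) \<in> R" using Suc.prems TS by auto
        with Suc.IH obtain s k where "s \<in> S" "k \<le> i" "(s, y) \<in> R ^^ k" by blast
        with y show ?thesis by (intro bexI[of _ s] exI[of _ "Suc k"]) auto
      qed
    qed
    \<comment> \<open>The increasing sets \<open>T i \<subseteq> A\<close> cannot grow by more than \<open>card A div K\<close> at each of \<open>K\<close> steps.\<close>
    have "\<exists>i<K. card (T (Suc i)) \<le> card (T i) + card A div K"
    proof (rule ccontr)
      assume "\<not> ?thesis"
      then have g: "card (T i) + Suc (card A div K) \<le> card (T (Suc i))" if "i < K" for i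
        using that by (metis Suc_leI add_Suc_right not_le)
      have "i * Suc (card A div K) \<le> card (T i)" if "i \<le> K" for i
        using that
      proof (induction i)
        case (Suc i)
        then show ?case using g[of i] by simp
      qed simp
      then have "K * Suc (card A div K) \<le> card (T K)" by simp
      also have "\<dots> \<le> card A" using TA fin by (simp add: card_mono)
      finally show False using K by (metis dividend_less_times_div mult_Suc_right add.commute not_le)
    qed
    then obtain i where i: "i < K" "card (T (Suc i)) \<le> card (T i) + card A div K" by blast
    let ?N = "R `` T i \<inter> B"
    have finN: "finite ?N" using fin by simp
    have "card (T i) \<le> card (T i \<inter> D) + card (A - D)"
    proof -
      have "T i \<subseteq> (T i \<inter> D) \<union> (A - D)" using TA by blast
      then have "card (T i) \<le> card ((T i \<inter> D) \<union> (A - D))" using fin finD by (intro card_mono) auto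
      then show ?thesis using card_Un_le le_trans by blast
    qed
    moreover have "card (T i \<inter> D) \<le> card ?N"
    proof (rule card_inj_on_le[OF _ _ finN])
      show "inj_on \<phi> (T i \<inter> D)" using D(2) by (auto simp: inj_on_def)
      show "\<phi> ` (T i \<inter> D) \<subseteq> ?N" using D near by auto
    qed
    moreover have "card (A - D) = card A - card D" using D finD by (simp add: card_Diff_subset)
    moreover have "card ?N = card (?N - A) + card (?N \<inter> A)"
      using finN by (metis Int_commute add.commute card_Int_Diff)
    moreover have "card (?N \<inter> A) + card S \<le> card (T (Suc i))"
    proof -
      have "card (?N \<inter> A) + card S = card ((?N \<inter> A) \<union> S)"
        using S finN fin by (subst card_Un_disjoint) (auto intro: finite_subset)
      also have "\<dots> \<le> card (T (Suc i))" using TS finT[of "Suc i"] by (intro card_mono) auto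
      finally show ?thesis .
    qed
    moreover have "card (?N - A) \<le> card (\<Union>(?r ` S))"
    proof (rule card_mono)
      show "finite (\<Union>(?r ` S))" by (rule finite_subset[of _ B]) (use fin in auto)
      show "?N - A \<subseteq> \<Union>(?r ` S)"
      proof
        fix y assume y: "y \<in> ?N - A"
        then obtain x where x: "x \<in> T i" "(x, y) \<in> R" by blast
        with reach obtain s k where "s \<in> S" "k \<le> i" "(s, x) \<in> R ^^ k" by blast
        with x i y have "s \<in> S" "k < K" "(s, y) \<in> R ^^ Suc k" by auto
        then show "y \<in> \<Union>(?r ` S)" using y by blast
      qed
    qed
    ultimately show ?thesis using i(2) by (simp add: d_def)
  qed
  then obtain D' \<psi> where D': "D' \<subseteq> A - B" "inj_on \<psi> D'" "\<And>x. x \<in> D' \<Longrightarrow> \<psi> x \<in> ?r x"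
    "card (A - B) \<le> card D' + d"
    using hall_deficiency[of "A - B" ?r d] fin by auto
  have "card A = card (A - B) + card (A \<inter> B)"
    using fin by (metis add.commute card_Int_Diff)
  with D' finD have "card D \<le> card D' + card (A \<inter> B) + card A div K" by (simp add: d_def)
  with D' show thesis by (intro that[of D' \<psi>]) auto
qed

section \<open>Coverings and their entourages\<close>

text \<open>
  Only the relation of lying in a common member matters for matchings, and relational composition
  replaces the bookkeeping with iterated stars.
\<close>

definition entourage :: "'a set set \<Rightarrow> ('a \<times> 'a) set" where
  "entourage \<U> = (\<Union>U\<in>\<U>. U \<times> U)"

lemma entourage_iff: "(x, y) \<in> entourage \<U> \<longleftrightarrow> (\<exists>U\<in>\<U>. x \<in> U \<and> y \<in> U)"
  by (auto simp: entourage_def)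

lemma entourage_sym: "(x, y) \<in> entourage \<U> \<Longrightarrow> (y, x) \<in> entourage \<U>"
  by (auto simp: entourage_iff)

lemma cover_star_singleton: "cover_star {x} \<U> = entourage \<U> `` {x}"
  by (auto simp: cover_star_def entourage_iff)

lemma refined_byD: "\<U> \<preceq> \<V> \<Longrightarrow> V \<in> \<V> \<Longrightarrow> \<exists>U\<in>\<U>. V \<subseteq> U"
  by (simp add: refined_by_def)

lemma entourage_mono:
  assumes "\<U> \<preceq> \<V>" shows "entourage \<V> \<subseteq> entourage \<U>"
proof
  fix p assume "p \<in> entourage \<V>"
  then obtain V where V: "V \<in> \<V>" "p \<in> V \<times> V" unfolding entourage_def by (rule UN_E)
  obtain U where "U \<in> \<U>" "V \<subseteq> U" using refined_byD[OF assms V(1)] by (rule bexE)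
  then show "p \<in> entourage \<U>" using V(2) unfolding entourage_def by (intro UN_I[of U]) auto
qed

lemma refined_by_refl: "\<U> \<preceq> \<U>"
  by (auto simp: refined_by_def)

lemma refined_by_trans: "\<U> \<preceq> \<V> \<Longrightarrow> \<V> \<preceq> \<W> \<Longrightarrow> \<U> \<preceq> \<W>"
  unfolding refined_by_def by (meson order_trans)

lemma refined_by_join: "\<U> \<preceq> \<U> \<or>\<^sub>c \<V>" "\<V> \<preceq> \<U> \<or>\<^sub>c \<V>"
  by (auto simp: refined_by_def cover_join_def)

lemma cover_join_eq_image: "\<U> \<or>\<^sub>c \<V> = (\<lambda>(U, V). U \<inter> V) ` (\<U> \<times> \<V>)"
proof (intro equalityI subsetI)
  fix x assume "x \<in> \<U> \<or>\<^sub>c \<V>"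
  then obtain U V where "x = U \<inter> V" "U \<in> \<U>" "V \<in> \<V>" unfolding cover_join_def by blast
  then show "x \<in> (\<lambda>(U, V). U \<inter> V) ` (\<U> \<times> \<V>)" by (intro image_eqI[of _ _ "(U, V)"]) simp_all
next
  fix x assume "x \<in> (\<lambda>(U, V). U \<inter> V) ` (\<U> \<times> \<V>)"
  then show "x \<in> \<U> \<or>\<^sub>c \<V>" unfolding cover_join_def by auto
qed

lemma finite_cover_join: "finite \<U> \<Longrightarrow> finite \<V> \<Longrightarrow> finite (\<U> \<or>\<^sub>c \<V>)"
  by (simp add: cover_join_eq_image)

lemma card_cover_join_le:
  assumes "finite \<U>" "finite \<V>"
  shows "card (\<U> \<or>\<^sub>c \<V>) \<le> card \<U> * card \<V>"
  unfolding cover_join_eq_image using card_image_le[of "\<U> \<times> \<V>" "\<lambda>(U, V). U \<inter> V"] assms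
  by (simp add: card_cartesian_product)

section \<open>Uniform coverings\<close>

locale covering_uniformity =
  fixes X :: "'a set" and \<D> :: "'a set set set"
  assumes uniform_space: "covering_uniform_space X \<D>"
begin

abbreviation fin_covs :: "'a set set set" where
  "fin_covs \<equiv> finite_uniform_coverings \<D>"

lemma uniformity: "uniformity_on X \<D>" and X_nonempty: "X \<noteq> {}"
  using uniform_space by (auto simp: covering_uniform_space_def)

lemma uniform_covering: "\<U> \<in> \<D> \<Longrightarrow> covering_of X \<U>"
  using uniformity by (auto simp: uniformity_on_def)

lemma member_subset: "\<U> \<in> \<D> \<Longrightarrow> U \<in> \<U> \<Longrightarrow> U \<subseteq> X"
  using uniform_covering by (auto simp: covering_of_def)

lemma member_containing:
  assumes "\<U> \<in> \<D>" "x \<in> X"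
  obtains U where "U \<in> \<U>" "x \<in> U"
  using uniform_covering[OF assms(1)] assms(2) unfolding covering_of_def by blast

lemma fin_covs_iff: "\<U> \<in> fin_covs \<longleftrightarrow> \<U> \<in> \<D> \<and> finite \<U>"
  by (simp add: finite_uniform_coverings_def)

lemma fin_covsD: "\<U> \<in> fin_covs \<Longrightarrow> \<U> \<in> \<D>" "\<U> \<in> fin_covs \<Longrightarrow> finite \<U>"
  by (auto simp: finite_uniform_coverings_def)

lemma fin_covsI: "\<U> \<in> \<D> \<Longrightarrow> finite \<U> \<Longrightarrow> \<U> \<in> fin_covs"
  by (auto simp: finite_uniform_coverings_def)

lemma refl_entourage: "\<U> \<in> \<D> \<Longrightarrow> x \<in> X \<Longrightarrow> (x, x) \<in> entourage \<U>"
  by (metis entourage_iff member_containing)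

lemma entourage_subset: "\<U> \<in> \<D> \<Longrightarrow> entourage \<U> \<subseteq> X \<times> X"
  using member_subset[of \<U>] unfolding entourage_def by blast

lemma star_refinement:
  assumes "\<U> \<in> \<D>" "\<V> \<in> \<D>"
  obtains \<W> where "\<W> \<in> \<D>" "\<U> \<preceq>\<^sup>* \<W>" "\<V> \<preceq>\<^sup>* \<W>"
  using uniformity assms unfolding uniformity_on_def by blast

text \<open>
  Empty members of a covering need no attention: since \<open>X\<close> is nonempty, a covering also has
  nonempty members, and the empty set lies in whatever contains one of those.
\<close>

lemma uniform_coveringI:
  assumes "\<W> \<in> \<D>" and sub: "\<And>V. V \<in> \<V> \<Longrightarrow> V \<subseteq> X"
    and ref: "\<And>W. W \<in> \<W> \<Longrightarrow> W \<noteq> {} \<Longrightarrow> \<exists>V\<in>\<V>. W \<subseteq> V"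
  shows "\<V> \<in> \<D>"
proof -
  have cov: "\<exists>V\<in>\<V>. x \<in> V" if "x \<in> X" for x
    by (rule member_containing[OF assms(1) that]) (use ref in blast)
  then have "covering_of X \<V>" using sub by (auto simp: covering_of_def)
  moreover have "\<V> \<preceq> \<W>"
    unfolding refined_by_def
  proof
    fix W assume "W \<in> \<W>"
    then show "\<exists>V\<in>\<V>. W \<subseteq> V" using ref cov X_nonempty by (cases "W = {}") auto
  qed
  ultimately show ?thesis using uniformity assms(1) unfolding uniformity_on_def by blast
qed

lemma join_uniform:
  assumes "\<U> \<in> \<D>" "\<V> \<in> \<D>"
  shows "\<U> \<or>\<^sub>c \<V> \<in> \<D>"
proof -
  obtain \<W> where \<W>: "\<W> \<in> \<D>" "\<U> \<preceq> \<W>" "\<V> \<preceq> \<W>"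
    using star_refinement[OF assms] refined_by_star by metis
  show ?thesis
  proof (rule uniform_coveringI[OF \<W>(1)])
    show "V \<subseteq> X" if "V \<in> \<U> \<or>\<^sub>c \<V>" for V
      using that member_subset[OF assms(1)] by (auto simp: cover_join_def)
    show "\<exists>V\<in>\<U> \<or>\<^sub>c \<V>. W \<subseteq> V" if "W \<in> \<W>" for W
    proof -
      have "\<exists>U\<in>\<U>. W \<subseteq> U" "\<exists>V\<in>\<V>. W \<subseteq> V"
        using that \<W>(2,3) unfolding refined_by_def by simp_all
      then obtain U V where "U \<in> \<U>" "V \<in> \<V>" "W \<subseteq> U" "W \<subseteq> V" by blast
      then show ?thesis by (intro bexI[of _ "U \<inter> V"]) (auto simp: cover_join_def)
    qed
  qed
qed

lemma join_fin_covs: "\<U> \<in> fin_covs \<Longrightarrow> \<V> \<in> fin_covs \<Longrightarrow> \<U> \<or>\<^sub>c \<V> \<in> fin_covs"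
  by (simp add: fin_covs_iff join_uniform finite_cover_join)

text \<open>
  Complexities and matching numbers are defined by finite coverings only, whereas the axioms of a
  uniformity do not make the star refinement of a finite covering finite.
  Shrink the members of \<open>\<U>\<close> to sets \<open>S U\<close> that still cover \<open>X\<close> and are at positive
  uniform distance from the complement of \<open>U\<close>, and sort the points of \<open>X\<close> by the set of those \<open>U\<close>
  that contain them: the sets \<open>\<Inter>A - \<Union>{S U | U \<in> \<U> - A}\<close>, for \<open>A \<subseteq> \<U>\<close>, form a finite covering,
  and one that contains a point of \<open>S U\<close> must have \<open>U \<in> A\<close>.
\<close>

lemma finite_barycentric_refinement:
  assumes U: "\<U> \<in> fin_covs"
  obtains \<W> where "\<W> \<in> fin_covs" "\<And>x. x \<in> X \<Longrightarrow> \<exists>U\<in>\<U>. cover_star {x} \<W> \<subseteq> U"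
proof -
  obtain \<V> where V: "\<V> \<in> \<D>" "\<U> \<preceq>\<^sup>* \<V>" using star_refinement fin_covsD(1)[OF U] by metis
  define S where "S U = {x \<in> X. cover_star {x} \<V> \<subseteq> U}" for U
  have S_cov: "\<exists>U\<in>\<U>. x \<in> S U" if x: "x \<in> X" for x
  proof -
    obtain v where v: "v \<in> \<V>" "x \<in> v" using V(1) x by (rule member_containing)
    then obtain U where "U \<in> \<U>" "cover_star v \<V> \<subseteq> U"
      using V(2) unfolding star_refined_by_def refined_by_def star_cover_def by blast
    moreover have "cover_star {x} \<V> \<subseteq> cover_star v \<V>" using v by (auto simp: cover_star_def)
    ultimately show ?thesis using x by (auto simp: S_def)
  qed
  define cell where "cell A = (X \<inter> \<Inter>A) - \<Union>(S ` (\<U> - A))" for A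
  show thesis
  proof (rule that[of "cell ` Pow \<U>"])
    show "cell ` Pow \<U> \<in> fin_covs"
    proof (rule fin_covsI)
      show "finite (cell ` Pow \<U>)" using U by (simp add: fin_covs_iff)
      show "cell ` Pow \<U> \<in> \<D>"
      proof (rule uniform_coveringI[OF V(1)])
        show "c \<subseteq> X" if "c \<in> cell ` Pow \<U>" for c using that by (auto simp: cell_def)
        fix v assume v: "v \<in> \<V>"
        let ?A = "{U \<in> \<U>. v \<inter> S U \<noteq> {}}"
        have "v \<subseteq> U" if "U \<in> ?A" for U
          using that v unfolding S_def cover_star_def by blast
        then have "v \<subseteq> cell ?A" using member_subset[OF V(1) v] by (auto simp: cell_def)
        then show "\<exists>c\<in>cell ` Pow \<U>. v \<subseteq> c" by blast
      qed
    qed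
    fix x assume "x \<in> X"
    then obtain U where U: "U \<in> \<U>" "x \<in> S U" using S_cov by blast
    have "c \<subseteq> U" if "c \<in> cell ` Pow \<U>" "x \<in> c" for c using that U by (auto simp: cell_def)
    then show "\<exists>U\<in>\<U>. cover_star {x} (cell ` Pow \<U>) \<subseteq> U"
      using U by (intro bexI[of _ U]) (auto simp: cover_star_def)
  qed
qed

lemma halving_entourage:
  assumes "\<U> \<in> fin_covs"
  obtains \<W> where "\<W> \<in> fin_covs" "entourage \<W> O entourage \<W> \<subseteq> entourage \<U>"
proof -
  obtain \<W> where W: "\<W> \<in> fin_covs" "\<And>x. x \<in> X \<Longrightarrow> \<exists>U\<in>\<U>. cover_star {x} \<W> \<subseteq> U"
    using finite_barycentric_refinement[OF assms] by blast
  have "(x, z) \<in> entourage \<U>" if "(x, y) \<in> entourage \<W>" "(y, z) \<in> entourage \<W>" for x y z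
  proof -
    have "y \<in> X" using that(1) entourage_subset[OF fin_covsD(1)[OF W(1)]] by blast
    then obtain U where "U \<in> \<U>" "entourage \<W> `` {y} \<subseteq> U"
      using W(2) unfolding cover_star_singleton by blast
    moreover have "x \<in> entourage \<W> `` {y}" "z \<in> entourage \<W> `` {y}"
      using that entourage_sym by auto
    ultimately show ?thesis unfolding entourage_iff by blast
  qed
  with W(1) that show thesis by blast
qed

lemma iterated_entourage:
  assumes "\<U> \<in> fin_covs"
  shows "\<exists>\<W>\<in>fin_covs. \<forall>k\<le>n. entourage \<W> ^^ Suc k \<subseteq> entourage \<U>"
using assms
proof (induction n arbitrary: \<U>)
  case 0
  then show ?case by (intro bexI[of _ \<U>]) auto
next
  case (Suc n)
  obtain \<V> where V: "\<V> \<in> fin_covs" "entourage \<V> O entourage \<V> \<subseteq> entourage \<U>"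
    using halving_entourage[OF Suc.prems] by blast
  have VU: "entourage \<V> \<subseteq> entourage \<U>"
    using V(2) entourage_subset[OF fin_covsD(1)[OF V(1)]] refl_entourage[OF fin_covsD(1)[OF V(1)]]
    by blast
  obtain \<W> where W: "\<W> \<in> fin_covs" "\<And>k. k \<le> n \<Longrightarrow> entourage \<W> ^^ Suc k \<subseteq> entourage \<V>"
    using Suc.IH[of \<V>] V by auto
  have WV: "entourage \<W> \<subseteq> entourage \<V>" using W(2)[of 0] by simp
  have "entourage \<W> ^^ Suc k \<subseteq> entourage \<U>" if k: "k \<le> Suc n" for k
  proof (cases k)
    case 0
    then show ?thesis using WV VU by simp
  next
    case (Suc j)
    then have "entourage \<W> ^^ Suc j O entourage \<W> \<subseteq> entourage \<V> O entourage \<V>"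
      using W(2)[of j] WV k by (intro relcomp_mono) auto
    then show ?thesis using V(2) Suc by simp
  qed
  then show ?case using W(1) by blast
qed

lemma vimage_uniform:
  assumes "uniform_continuous_map X \<D> X \<D> f" "\<U> \<in> \<D>"
  shows "(\<lambda>U. f -` U \<inter> X) ` \<U> \<in> \<D>"
  using assms by (auto simp: uniform_continuous_map_def Setcompr_eq_image)

text \<open>
  Finitely many uniformly continuous maps have a common modulus of continuity.
\<close>

lemma equicontinuous_entourage:
  assumes "finite E" "\<And>f. f \<in> E \<Longrightarrow> uniform_continuous_map X \<D> X \<D> f" "\<U> \<in> fin_covs"
  shows "\<exists>\<W>\<in>fin_covs. entourage \<W> \<subseteq> entourage \<U> \<and>
    (\<forall>f\<in>E. \<forall>x y. (x, y) \<in> entourage \<W> \<longrightarrow> (f x, f y) \<in> entourage \<U>)"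
  using assms(1,2)
proof (induction E)
  case empty
  then show ?case using assms(3) by auto
next
  case (insert f E)
  then have "\<exists>\<W>\<in>fin_covs. entourage \<W> \<subseteq> entourage \<U> \<and>
      (\<forall>f\<in>E. \<forall>x y. (x, y) \<in> entourage \<W> \<longrightarrow> (f x, f y) \<in> entourage \<U>)"
    by simp
  then obtain \<W> where W: "\<W> \<in> fin_covs" "entourage \<W> \<subseteq> entourage \<U>"
    and WE: "\<forall>f\<in>E. \<forall>x y. (x, y) \<in> entourage \<W> \<longrightarrow> (f x, f y) \<in> entourage \<U>"
    by (elim bexE conjE)
  let ?P = "(\<lambda>U. f -` U \<inter> X) ` \<U>"
  have P: "?P \<in> fin_covs"
    using vimage_uniform[of f \<U>] insert.prems assms(3) by (simp add: fin_covs_iff)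
  have Pf: "(f x, f y) \<in> entourage \<U>" if "(x, y) \<in> entourage ?P" for x y
    using that by (auto simp: entourage_iff)
  have sub: "entourage (\<W> \<or>\<^sub>c ?P) \<subseteq> entourage \<W>" "entourage (\<W> \<or>\<^sub>c ?P) \<subseteq> entourage ?P"
    by (rule entourage_mono, rule refined_by_join)+
  show ?case
  proof (intro bexI[of _ "\<W> \<or>\<^sub>c ?P"] conjI ballI allI impI)
    show "\<W> \<or>\<^sub>c ?P \<in> fin_covs" using join_fin_covs[OF W(1) P] .
    show "entourage (\<W> \<or>\<^sub>c ?P) \<subseteq> entourage \<U>" using sub(1) W(2) by (rule subset_trans)
    fix h x y assume h: "h \<in> insert f E" and xy: "(x, y) \<in> entourage (\<W> \<or>\<^sub>c ?P)"
    show "(h x, h y) \<in> entourage \<U>"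
    proof (cases "h = f")
      case True
      then show ?thesis using Pf[OF subsetD[OF sub(2) xy]] by simp
    next
      case False
      then show ?thesis using WE subsetD[OF sub(1) xy] h by simp
    qed
  qed
qed

section \<open>Neighbourhoods\<close>

definition nbhd :: "'a \<Rightarrow> 'a set \<Rightarrow> bool" where
  "nbhd x S \<longleftrightarrow> (\<exists>\<U>\<in>\<D>. cover_star {x} \<U> \<subseteq> S)"

lemma nbhd_entourage: "\<U> \<in> \<D> \<Longrightarrow> nbhd x (entourage \<U> `` {x})"
  by (auto simp: nbhd_def cover_star_singleton)

lemma nbhd_mono: "nbhd x S \<Longrightarrow> S \<subseteq> T \<Longrightarrow> nbhd x T"
  unfolding nbhd_def by blast

lemma nbhd_Int:
  assumes "nbhd x S" "nbhd x T" shows "nbhd x (S \<inter> T)"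
proof -
  obtain \<U> \<V> where "\<U> \<in> \<D>" "\<V> \<in> \<D>" "cover_star {x} \<U> \<subseteq> S" "cover_star {x} \<V> \<subseteq> T"
    using assms by (auto simp: nbhd_def)
  moreover have "cover_star {x} (\<U> \<or>\<^sub>c \<V>) \<subseteq> cover_star {x} \<U>"
    "cover_star {x} (\<U> \<or>\<^sub>c \<V>) \<subseteq> cover_star {x} \<V>"
    by (rule cover_star_mono, rule refined_by_join)+
  ultimately show ?thesis unfolding nbhd_def using join_uniform by blast
qed

text \<open>
  The members of a uniform covering need not be open, but their interiors still cover the space.
\<close>

lemma nbhd_member:
  assumes "\<U> \<in> \<D>" "x \<in> X"
  obtains U where "U \<in> \<U>" "nbhd x U"
proof -
  obtain \<V> where V: "\<V> \<in> \<D>" "\<U> \<preceq>\<^sup>* \<V>" using star_refinement assms by metis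
  obtain v where v: "v \<in> \<V>" "x \<in> v" using V(1) assms(2) by (rule member_containing)
  then obtain U where "U \<in> \<U>" "cover_star v \<V> \<subseteq> U"
    using V(2) unfolding star_refined_by_def refined_by_def star_cover_def by blast
  moreover have "cover_star {x} \<V> \<subseteq> cover_star v \<V>" using v by (auto simp: cover_star_def)
  ultimately show thesis using that V(1) unfolding nbhd_def by blast
qed

lemma uniform_nbhds:
  assumes "finite T" "\<And>t. t \<in> T \<Longrightarrow> nbhd t (c t)" "\<U> \<in> \<D>"
  obtains \<W> where "\<W> \<in> \<D>" "\<U> \<preceq> \<W>" "\<And>t. t \<in> T \<Longrightarrow> cover_star {t} \<W> \<subseteq> c t"
proof -
  have "\<exists>\<W>\<in>\<D>. \<U> \<preceq> \<W> \<and> (\<forall>t\<in>T. cover_star {t} \<W> \<subseteq> c t)"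
    using assms(1,2)
  proof (induction T)
    case empty
    then show ?case using assms(3) refined_by_refl by auto
  next
    case (insert t T)
    then obtain \<W> where W: "\<W> \<in> \<D>" "\<U> \<preceq> \<W>" "\<forall>t\<in>T. cover_star {t} \<W> \<subseteq> c t" by auto
    obtain \<V> where V: "\<V> \<in> \<D>" "cover_star {t} \<V> \<subseteq> c t" using insert.prems unfolding nbhd_def by blast
    have sub: "cover_star {s} (\<W> \<or>\<^sub>c \<V>) \<subseteq> cover_star {s} \<W>"
      "cover_star {s} (\<W> \<or>\<^sub>c \<V>) \<subseteq> cover_star {s} \<V>" for s
      by (rule cover_star_mono, rule refined_by_join)+
    have "cover_star {s} (\<W> \<or>\<^sub>c \<V>) \<subseteq> c s" if "s \<in> insert t T" for s
      using that W(3) V(2) sub[of s] by (cases "s = t") (auto intro: subset_trans)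
    then show ?case
      using W V join_uniform refined_by_trans[OF W(2) refined_by_join(1)]
      by (intro bexI[of _ "\<W> \<or>\<^sub>c \<V>"]) auto
  qed
  then show thesis using that by blast
qed

text \<open>
  A member of a sufficiently fine covering either contains a point \<open>t\<close> of \<open>T\<close>, and then lies in the
  neighbourhood \<open>c t\<close>, or it avoids \<open>T\<close> altogether.
\<close>

lemma punctured_covering:
  assumes "\<U> \<in> fin_covs" "finite T" "\<And>t. t \<in> T \<Longrightarrow> nbhd t (c t) \<and> c t \<subseteq> X"
  shows "c ` T \<union> (\<lambda>U. U - T) ` \<U> \<in> fin_covs"
proof (rule fin_covsI)
  show "finite (c ` T \<union> (\<lambda>U. U - T) ` \<U>)" using assms(1,2) by (simp add: fin_covs_iff)
  obtain \<W> where W: "\<W> \<in> \<D>" "\<U> \<preceq> \<W>" "\<And>t. t \<in> T \<Longrightarrow> cover_star {t} \<W> \<subseteq> c t"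
    using uniform_nbhds[of T c \<U>] assms(2,3) fin_covsD(1)[OF assms(1)] by metis
  show "c ` T \<union> (\<lambda>U. U - T) ` \<U> \<in> \<D>"
  proof (rule uniform_coveringI[OF W(1)])
    show "V \<subseteq> X" if "V \<in> c ` T \<union> (\<lambda>U. U - T) ` \<U>" for V
      using that assms(3) member_subset[OF fin_covsD(1)[OF assms(1)]] by auto
    fix w assume w: "w \<in> \<W>"
    show "\<exists>V\<in>c ` T \<union> (\<lambda>U. U - T) ` \<U>. w \<subseteq> V"
    proof (cases "w \<inter> T = {}")
      case True
      obtain U where "U \<in> \<U>" "w \<subseteq> U" using W(2) w by (auto simp: refined_by_def)
      then show ?thesis using True by (intro bexI[of _ "U - T"]) auto
    next
      case False
      then obtain t where t: "t \<in> T" "t \<in> w" by blast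
      then have "w \<subseteq> cover_star {t} \<W>" using w by (auto simp: cover_star_def)
      then show ?thesis using W(3)[OF t(1)] t(1) by blast
    qed
  qed
qed

section \<open>Uniform automorphisms\<close>

abbreviation Aut :: "('a \<Rightarrow> 'a) set" where
  "Aut \<equiv> carrier (uniform_Aut X \<D>)"

lemma Aut_bij: "g \<in> Aut \<Longrightarrow> bij_betw g X X"
  by (simp add: uniform_Aut_def Bij_def)

lemma Aut_continuous:
  assumes "g \<in> Aut"
  shows "uniform_continuous_map X \<D> X \<D> g" "uniform_continuous_map X \<D> X \<D> (inv_into X g)"
  using assms by (auto simp: uniform_Aut_def)

lemma Aut_inv:
  assumes "g \<in> Aut" "x \<in> X"
  shows "g x \<in> X" "inv_into X g x \<in> X" "g (inv_into X g x) = x" "inv_into X g (g x) = x"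
  using Aut_bij[OF assms(1)] assms(2)
  by (auto simp: bij_betw_inv_into_right bij_betw_inv_into_left bij_betw_apply
      intro: bij_betw_apply[OF bij_betw_inv_into])

lemma Aut_inj_on: "g \<in> Aut \<Longrightarrow> F \<subseteq> X \<Longrightarrow> inj_on g F"
  using Aut_bij bij_betw_imp_inj_on inj_on_subset by blast

lemma Aut_image_eq_vimage: "g \<in> Aut \<Longrightarrow> U \<subseteq> X \<Longrightarrow> g ` U = inv_into X g -` U \<inter> X"
  using Aut_inv[of g] by (auto simp: image_iff subset_iff) metis

lemma image_uniform:
  assumes "g \<in> Aut" "\<U> \<in> \<D>"
  shows "(`) g ` \<U> \<in> \<D>"
proof -
  have "(`) g ` \<U> = (\<lambda>U. inv_into X g -` U \<inter> X) ` \<U>"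
    using Aut_image_eq_vimage[OF assms(1)] member_subset[OF assms(2)] by (intro image_cong) auto
  then show ?thesis using vimage_uniform[OF Aut_continuous(2)[OF assms(1)] assms(2)] by simp
qed

lemma image_fin_covs: "g \<in> Aut \<Longrightarrow> \<U> \<in> fin_covs \<Longrightarrow> (`) g ` \<U> \<in> fin_covs"
  by (simp add: fin_covs_iff image_uniform)

lemma nbhd_image:
  assumes "g \<in> Aut" "nbhd x S" "x \<in> X" "S \<subseteq> X"
  shows "nbhd (g x) (g ` S)"
proof -
  obtain \<U> where U: "\<U> \<in> \<D>" "cover_star {x} \<U> \<subseteq> S" using assms by (auto simp: nbhd_def)
  have "cover_star {g x} ((`) g ` \<U>) \<subseteq> g ` S"
  proof
    fix z assume "z \<in> cover_star {g x} ((`) g ` \<U>)"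
    then obtain u where u: "u \<in> \<U>" "g x \<in> g ` u" "z \<in> g ` u" by (auto simp: cover_star_def)
    have "x \<in> u"
      using u(2) assms(3) member_subset[OF U(1) u(1)] Aut_inj_on[OF assms(1) order_refl]
      by (simp add: inj_on_image_mem_iff)
    then have "u \<subseteq> S" using U u(1) by (auto simp: cover_star_def)
    then show "z \<in> g ` S" using u(3) by blast
  qed
  then show ?thesis using image_uniform[OF assms(1) U(1)] by (auto simp: nbhd_def)
qed

section \<open>Uniform complexity\<close>

lemma uniform_complexity_le:
  "\<V> \<in> fin_covs \<Longrightarrow> \<U> \<preceq> \<V> \<Longrightarrow> uniform_complexity \<D> \<U> \<le> card \<V>"
  unfolding uniform_complexity_def by (rule cINF_lower) auto

lemma uniform_complexity_attained:
  assumes "\<U> \<in> fin_covs"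
  obtains \<V> where "\<V> \<in> fin_covs" "\<U> \<preceq> \<V>" "card \<V> = uniform_complexity \<D> \<U>"
proof -
  have "uniform_complexity \<D> \<U> \<in> card ` {\<V> \<in> fin_covs. \<U> \<preceq> \<V>}"
    unfolding uniform_complexity_def using assms refined_by_refl by (intro Inf_nat_def1) blast
  then show thesis using that by auto
qed

lemma uniform_complexity_pos:
  assumes "\<U> \<in> fin_covs" shows "0 < uniform_complexity \<D> \<U>"
proof -
  obtain \<V> where V: "\<V> \<in> fin_covs" "card \<V> = uniform_complexity \<D> \<U>"
    using uniform_complexity_attained[OF assms] by blast
  obtain x where "x \<in> X" using X_nonempty by blast
  then have "\<V> \<noteq> {}" by (rule member_containing[OF fin_covsD(1)[OF V(1)]]) blast
  then show ?thesis using V by (simp add: fin_covs_iff card_gt_0_iff flip: V(2))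
qed

end

section \<open>Perfect Hausdorff uniform spaces\<close>

locale perfect_hausdorff_uniformity = covering_uniformity +
  assumes hausdorff: "Hausdorff_space (uniform_topology X \<D>)"
    and perfect: "no_isolated_points (uniform_topology X \<D>)"
begin

lemma nbhd_remove_finite:
  assumes "finite T" "T \<subseteq> X" "x \<in> X" "nbhd x S"
  shows "nbhd x (S - (T - {x}))"
  using assms(1,2)
proof (induction T)
  case (insert y T)
  show ?case
  proof (cases "y = x")
    case False
    then obtain O\<^sub>x where "openin (uniform_topology X \<D>) O\<^sub>x" "x \<in> O\<^sub>x" "y \<notin> O\<^sub>x"
      using hausdorff insert.prems assms(3) topspace_uniform_topology[OF uniformity]
      unfolding Hausdorff_space_def disjnt_iff by (metis insert_subset)
    then have "nbhd x O\<^sub>x" "O\<^sub>x \<subseteq> - {y}"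
      using openin_uniform_topology[OF uniformity] by (auto simp: nbhd_def)
    then have "nbhd x (- {y})" using nbhd_mono by blast
    then have "nbhd x ((S - (T - {x})) \<inter> - {y})" using insert by (intro nbhd_Int) auto
    then show ?thesis by (rule nbhd_mono) auto
  qed (use insert in auto)
qed (use assms in auto)

text \<open>
  Removing the other points of a finite neighbourhood would make \<open>x\<close> isolated.
\<close>

lemma infinite_nbhd:
  assumes "x \<in> X" "nbhd x S" "S \<subseteq> X"
  shows "infinite S"
proof
  assume "finite S"
  then have "nbhd x (S - (S - {x}))" using nbhd_remove_finite assms by blast
  then have "nbhd x {x}" by (rule nbhd_mono) blast
  then have "openin (uniform_topology X \<D>) {x}"
    using assms(1) openin_uniform_topology[OF uniformity] by (auto simp: nbhd_def)
  then show False
    using perfect assms(1) topspace_uniform_topology[OF uniformity] by (auto simp: no_isolated_points_def)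
qed

end

section \<open>Matching numbers\<close>

lemma matching_number_ge:
  assumes "finite A" "D \<subseteq> A" "inj_on \<phi> D" "\<phi> ` D \<subseteq> B" "\<And>x. x \<in> D \<Longrightarrow> (x, \<phi> x) \<in> entourage \<U>"
  shows "card D \<le> matching_number A B \<U>"
  unfolding matching_number_def
proof (rule Max_ge)
  show "finite {card D |D. D \<subseteq> A \<and> (\<exists>\<phi>. inj_on \<phi> D \<and> \<phi> \<in> D \<rightarrow> B \<and> (\<forall>x\<in>D. \<exists>U\<in>\<U>. {x, \<phi> x} \<subseteq> U))}"
    by (rule finite_subset[of _ "{..card A}"]) (use assms(1) card_mono in auto)
  have "\<phi> \<in> D \<rightarrow> B" "\<forall>x\<in>D. \<exists>U\<in>\<U>. {x, \<phi> x} \<subseteq> U"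
    using assms(4,5) by (auto simp: entourage_iff)
  then show "card D \<in> {card D |D. D \<subseteq> A \<and> (\<exists>\<phi>. inj_on \<phi> D \<and> \<phi> \<in> D \<rightarrow> B \<and> (\<forall>x\<in>D. \<exists>U\<in>\<U>. {x, \<phi> x} \<subseteq> U))}"
    using assms(2,3) by blast
qed

lemma matching_number_attained:
  assumes "finite A"
  obtains D \<phi> where "D \<subseteq> A" "inj_on \<phi> D" "\<phi> ` D \<subseteq> B" "\<And>x. x \<in> D \<Longrightarrow> (x, \<phi> x) \<in> entourage \<U>"
    "card D = matching_number A B \<U>"
proof -
  let ?M = "{card D |D. D \<subseteq> A \<and> (\<exists>\<phi>. inj_on \<phi> D \<and> \<phi> \<in> D \<rightarrow> B \<and> (\<forall>x\<in>D. \<exists>U\<in>\<U>. {x, \<phi> x} \<subseteq> U))}"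
  have "finite ?M"
    by (rule finite_subset[of _ "{..card A}"]) (use assms(1) card_mono in auto)
  moreover have "card {} \<in> ?M" by (intro CollectI exI[of _ "{}"]) auto
  ultimately have "Max ?M \<in> ?M" by (metis (lifting) Max_in empty_iff)
  then obtain D \<phi> where D: "D \<subseteq> A" "card D = Max ?M" "inj_on \<phi> D" "\<phi> \<in> D \<rightarrow> B"
    "\<forall>x\<in>D. \<exists>U\<in>\<U>. {x, \<phi> x} \<subseteq> U" by force
  show thesis
  proof (rule that[OF D(1,3)])
    show "\<phi> ` D \<subseteq> B" using D(4) by blast
    show "(x, \<phi> x) \<in> entourage \<U>" if "x \<in> D" for x
      using D(5) that by (simp add: entourage_iff)
    show "card D = matching_number A B \<U>" using D(2) by (simp add: matching_number_def)
  qed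
qed

section \<open>From coverings to matchings\<close>

context perfect_hausdorff_uniformity
begin

text \<open>
  If fewer than \<open>card \<S>\<close> members of \<open>\<Z>\<close> met the union of \<open>\<S>\<close>, they could replace \<open>\<S>\<close> in \<open>\<V>\<^sub>0\<close>.
\<close>

lemma minimal_refinement_exchange:
  assumes V0: "\<V>\<^sub>0 \<in> fin_covs" "\<V> \<preceq> \<V>\<^sub>0"
    and minimal: "\<And>\<V>'. \<V>' \<in> fin_covs \<Longrightarrow> \<V> \<preceq> \<V>' \<Longrightarrow> card \<V>\<^sub>0 \<le> card \<V>'"
    and Z: "\<Z> \<in> fin_covs" "\<V> \<preceq> \<Z>" and S: "\<S> \<subseteq> \<V>\<^sub>0"
  shows "card \<S> \<le> card {Z \<in> \<Z>. \<exists>V\<in>\<S>. Z \<inter> V \<noteq> {}}"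
proof -
  let ?Z = "{Z \<in> \<Z>. \<exists>V\<in>\<S>. Z \<inter> V \<noteq> {}}" and ?N = "\<V>\<^sub>0 - \<S>"
  have fin: "finite \<V>\<^sub>0" "finite ?Z" using V0 Z by (simp_all add: fin_covs_iff)
  have "?N \<union> ?Z \<in> \<D>"
  proof (rule uniform_coveringI[OF join_uniform[OF fin_covsD(1)[OF V0(1)] fin_covsD(1)[OF Z(1)]]])
    show "A \<subseteq> X" if "A \<in> ?N \<union> ?Z" for A
      using that member_subset[OF fin_covsD(1)[OF V0(1)]] member_subset[OF fin_covsD(1)[OF Z(1)]]
      by auto
    fix W assume "W \<in> \<V>\<^sub>0 \<or>\<^sub>c \<Z>" and ne: "W \<noteq> {}"
    then obtain V Z where VZ: "W = V \<inter> Z" "V \<in> \<V>\<^sub>0" "Z \<in> \<Z>" unfolding cover_join_def by blast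
    show "\<exists>A\<in>?N \<union> ?Z. W \<subseteq> A"
    proof (cases "V \<in> \<S>")
      case True
      then have "Z \<in> ?Z" using VZ ne by blast
      then show ?thesis using VZ(1) by (intro bexI[of _ Z]) auto
    next
      case False
      then show ?thesis using VZ by (intro bexI[of _ V]) auto
    qed
  qed
  then have "?N \<union> ?Z \<in> fin_covs" using fin by (simp add: fin_covs_iff)
  moreover have "\<V> \<preceq> ?N \<union> ?Z"
    using V0(2) Z(2) unfolding refined_by_def by (simp add: ball_Un)
  ultimately have "card \<V>\<^sub>0 \<le> card (?N \<union> ?Z)" by (rule minimal)
  also have "\<dots> \<le> card ?N + card ?Z" by (rule card_Un_le)
  also have "card ?N = card \<V>\<^sub>0 - card \<S>"
    using S fin(1) by (simp add: card_Diff_subset finite_subset)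
  finally show ?thesis using card_mono[OF fin(1) S] by linarith
qed

text \<open>
  Every small enough set lies in a member of \<open>\<V>\<^sub>0\<close> that is a neighbourhood of one of its points, hence
  infinite; a finite member is therefore dispensable.
\<close>

lemma infinite_member_of_minimal_refinement:
  assumes V0: "\<V>\<^sub>0 \<in> fin_covs" "\<V> \<preceq> \<V>\<^sub>0"
    and minimal: "\<And>\<V>'. \<V>' \<in> fin_covs \<Longrightarrow> \<V> \<preceq> \<V>' \<Longrightarrow> card \<V>\<^sub>0 \<le> card \<V>'"
    and V: "V \<in> \<V>\<^sub>0"
  shows "infinite V"
proof
  assume fin: "finite V"
  have D0: "\<V>\<^sub>0 \<in> \<D>" "finite \<V>\<^sub>0" using V0 by (simp_all add: fin_covs_iff)
  obtain \<W> where W: "\<W> \<in> \<D>" "\<V>\<^sub>0 \<preceq>\<^sup>* \<W>" using star_refinement[OF D0(1) D0(1)] by blast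
  have "\<V>\<^sub>0 - {V} \<in> \<D>"
  proof (rule uniform_coveringI[OF W(1)])
    show "A \<subseteq> X" if "A \<in> \<V>\<^sub>0 - {V}" for A using that member_subset[OF D0(1)] by blast
    fix w assume w: "w \<in> \<W>" "w \<noteq> {}"
    then obtain x where x: "x \<in> w" by blast
    then have "x \<in> X" using member_subset[OF W(1) w(1)] by blast
    obtain U where U: "U \<in> \<V>\<^sub>0" "cover_star w \<W> \<subseteq> U"
      using W(2) w(1) unfolding star_refined_by_def refined_by_def star_cover_def by blast
    have "cover_star {x} \<W> \<subseteq> cover_star w \<W>" using x by (auto simp: cover_star_def)
    then have "nbhd x U" using U(2) W(1) unfolding nbhd_def by blast
    then have "infinite U" using infinite_nbhd \<open>x \<in> X\<close> member_subset[OF D0(1) U(1)] by blast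
    then have "U \<noteq> V" using fin by blast
    moreover have "w \<subseteq> U" using U(2) w by (auto simp: cover_star_def)
    ultimately show "\<exists>A\<in>\<V>\<^sub>0 - {V}. w \<subseteq> A" using U(1) by blast
  qed
  then have "\<V>\<^sub>0 - {V} \<in> fin_covs" using D0 by (simp add: fin_covs_iff)
  moreover have "\<V> \<preceq> \<V>\<^sub>0 - {V}" using V0(2) by (simp add: refined_by_def)
  ultimately have "card \<V>\<^sub>0 \<le> card (\<V>\<^sub>0 - {V})" by (rule minimal)
  then show False using card_Diff1_less[OF D0(2) V] by linarith
qed

text \<open>
  Matched representatives are linked by a chain of three steps: from the representative of \<open>v\<close> within
  \<open>v\<close> to a point of some \<open>Z \<in> \<Z>\<close>, within \<open>Z\<close> to a point of \<open>g w\<close>, and within \<open>g w\<close> to the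
  image of the representative of \<open>w\<close>. For the last step to be small, \<open>w\<close> has to be small
  even after \<open>g\<close> is applied, which explains the choice of \<open>\<U>'\<close>.
\<close>

lemma matching_from_coverings:
  assumes E: "finite E" "E \<subseteq> Aut" and U: "\<U> \<in> fin_covs"
  shows "\<exists>\<U>'\<in>fin_covs. \<forall>\<V>\<in>fin_covs. \<U>' \<preceq> \<V> \<longrightarrow>
    (\<exists>F. finite F \<and> F \<subseteq> X \<and> card F = uniform_complexity \<D> \<V> \<and>
      (\<forall>g\<in>E. 2 * card F \<le> uniform_complexity \<D> (\<V> \<or>\<^sub>c (`) g ` \<V>) + matching_number F (g ` F) \<U>))"
proof -
  obtain \<U>\<^sub>1 where U1: "\<U>\<^sub>1 \<in> fin_covs" "\<And>k. k \<le> 2 \<Longrightarrow> entourage \<U>\<^sub>1 ^^ Suc k \<subseteq> entourage \<U>"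
    using iterated_entourage[OF U, of 2] by auto
  have "entourage \<U>\<^sub>1 ^^ Suc 2 = entourage \<U>\<^sub>1 O entourage \<U>\<^sub>1 O entourage \<U>\<^sub>1"
    by (simp add: numeral_2_eq_2 O_assoc)
  then have three: "entourage \<U>\<^sub>1 O entourage \<U>\<^sub>1 O entourage \<U>\<^sub>1 \<subseteq> entourage \<U>" using U1(2)[of 2] by simp
  have "\<exists>\<U>'\<in>fin_covs. entourage \<U>' \<subseteq> entourage \<U>\<^sub>1 \<and>
      (\<forall>g\<in>E. \<forall>x y. (x, y) \<in> entourage \<U>' \<longrightarrow> (g x, g y) \<in> entourage \<U>\<^sub>1)"
    using E Aut_continuous(1) by (intro equicontinuous_entourage[OF E(1) _ U1(1)]) blast
  then obtain \<U>' where U': "\<U>' \<in> fin_covs" "entourage \<U>' \<subseteq> entourage \<U>\<^sub>1"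
    and U'g: "\<And>g x y. g \<in> E \<Longrightarrow> (x, y) \<in> entourage \<U>' \<Longrightarrow> (g x, g y) \<in> entourage \<U>\<^sub>1"
    by (elim bexE conjE) simp
  show ?thesis
  proof (rule bexI[OF _ U'(1)], intro ballI impI)
    fix \<V> assume V: "\<V> \<in> fin_covs" and ref: "\<U>' \<preceq> \<V>"
    obtain \<V>\<^sub>0 where V0: "\<V>\<^sub>0 \<in> fin_covs" "\<V> \<preceq> \<V>\<^sub>0" "card \<V>\<^sub>0 = uniform_complexity \<D> \<V>"
      using uniform_complexity_attained[OF V] .
    let ?n = "card \<V>\<^sub>0"
    have minimal: "?n \<le> card \<V>'" if "\<V>' \<in> fin_covs" "\<V> \<preceq> \<V>'" for \<V>'
      using uniform_complexity_le[OF that] V0(3) by simp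
    have fin0: "finite \<V>\<^sub>0" using V0(1) by (simp add: fin_covs_iff)
    obtain p where p: "inj_on p \<V>\<^sub>0" "\<And>v. v \<in> \<V>\<^sub>0 \<Longrightarrow> p v \<in> v"
      using distinct_representatives_of_infinite_sets[OF fin0, of "\<lambda>v. v"]
        infinite_member_of_minimal_refinement[OF V0(1,2) minimal] by blast
    have near0: "(x, y) \<in> entourage \<U>'" if "v \<in> \<V>\<^sub>0" "x \<in> v" "y \<in> v" for v x y
    proof (rule subsetD[OF entourage_mono[OF refined_by_trans[OF ref V0(2)]]])
      show "(x, y) \<in> entourage \<V>\<^sub>0" unfolding entourage_iff using that by blast
    qed
    define F where "F = p ` \<V>\<^sub>0"
    have F: "finite F" "F \<subseteq> X" "card F = ?n"
    proof -
      show "finite F" unfolding F_def using fin0 by (rule finite_imageI)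
      show "card F = ?n" unfolding F_def by (rule card_image[OF p(1)])
      show "F \<subseteq> X"
        unfolding F_def using p(2) member_subset[OF fin_covsD(1)[OF V0(1)]] by blast
    qed
    have "2 * card F \<le> uniform_complexity \<D> (\<V> \<or>\<^sub>c (`) g ` \<V>) + matching_number F (g ` F) \<U>"
      if g: "g \<in> E" for g
    proof -
      have gA: "g \<in> Aut" using E g by blast
      note inv = Aut_inv[OF gA]
      obtain \<Z> where Z: "\<Z> \<in> fin_covs" "\<V> \<or>\<^sub>c (`) g ` \<V> \<preceq> \<Z>"
        "card \<Z> = uniform_complexity \<D> (\<V> \<or>\<^sub>c (`) g ` \<V>)"
        using uniform_complexity_attained[OF join_fin_covs[OF V image_fin_covs[OF gA V]]] .
      have VZ: "\<V> \<preceq> \<Z>" and gVZ: "(`) g ` \<V> \<preceq> \<Z>"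
        using refined_by_trans[OF refined_by_join(1) Z(2)] refined_by_trans[OF refined_by_join(2) Z(2)] .
      have finZ: "finite \<Z>" using Z(1) by (simp add: fin_covs_iff)
      let ?pre = "\<lambda>Z. g -` Z \<inter> X"
      have preZ: "?pre ` \<Z> \<in> fin_covs"
        using vimage_uniform[OF Aut_continuous(1)[OF gA]] Z(1) by (simp add: fin_covs_iff)
      have VpreZ: "\<V> \<preceq> ?pre ` \<Z>"
        unfolding refined_by_def
      proof
        fix W assume "W \<in> ?pre ` \<Z>"
        then obtain Z where Z: "Z \<in> \<Z>" "W = ?pre Z" by blast
        then obtain V where V: "V \<in> \<V>" "Z \<subseteq> g ` V" using refined_byD[OF gVZ] by blast
        have "V \<subseteq> X" using member_subset[OF fin_covsD(1)[OF \<open>\<V> \<in> fin_covs\<close>] V(1)] .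
        have "W \<subseteq> V"
        proof
          fix x assume "x \<in> W"
          then obtain y where "x \<in> X" "y \<in> V" "g x = g y" using Z V by blast
          then show "x \<in> V" using inv(4)[of x] inv(4)[of y] \<open>V \<subseteq> X\<close> by auto
        qed
        then show "\<exists>V\<in>\<V>. W \<subseteq> V" using V(1) by blast
      qed
      define r where "r v = {w \<in> \<V>\<^sub>0. \<exists>Z\<in>\<Z>. Z \<inter> v \<noteq> {} \<and> ?pre Z \<inter> w \<noteq> {}}" for v
      have hall: "card S + ?n \<le> card (\<Union>(r ` S)) + card \<Z>" if S: "S \<subseteq> \<V>\<^sub>0" for S
      proof -
        \<comment> \<open>By the choice of \<open>T\<close>, no member of \<open>\<Z>\<close> meets both a member of \<open>S\<close> and the image of a member of \<open>T\<close>.\<close>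
        let ?T = "\<V>\<^sub>0 - \<Union>(r ` S)"
        let ?ZS = "{Z \<in> \<Z>. \<exists>v\<in>S. Z \<inter> v \<noteq> {}}" and ?ZT = "{Z \<in> \<Z>. \<exists>w\<in>?T. ?pre Z \<inter> w \<noteq> {}}"
        have rS: "\<Union>(r ` S) \<subseteq> \<V>\<^sub>0" by (auto simp: r_def)
        have "card S \<le> card ?ZS"
          by (rule minimal_refinement_exchange[OF V0(1,2) minimal Z(1) VZ S])
        moreover have "card ?T \<le> card ?ZT"
        proof -
          have "card ?T \<le> card {Z' \<in> ?pre ` \<Z>. \<exists>w\<in>?T. Z' \<inter> w \<noteq> {}}"
            by (rule minimal_refinement_exchange[OF V0(1,2) minimal preZ VpreZ]) auto
          also have "{Z' \<in> ?pre ` \<Z>. \<exists>w\<in>?T. Z' \<inter> w \<noteq> {}} = ?pre ` ?ZT" by blast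
          also have "card \<dots> \<le> card ?ZT" using finZ by (intro card_image_le) simp
          finally show ?thesis .
        qed
        moreover have "card ?ZS + card ?ZT \<le> card \<Z>"
        proof -
          have "?ZS \<inter> ?ZT = {}" using S unfolding r_def by blast
          then have "card ?ZS + card ?ZT = card (?ZS \<union> ?ZT)"
            using finZ by (simp add: card_Un_disjoint)
          also have "\<dots> \<le> card \<Z>" using finZ by (intro card_mono) auto
          finally show ?thesis .
        qed
        moreover have "card ?T = ?n - card (\<Union>(r ` S))" "card (\<Union>(r ` S)) \<le> ?n"
          using rS fin0 finite_subset[OF rS fin0] by (simp_all add: card_Diff_subset card_mono)
        ultimately show ?thesis by linarith
      qed
      have le: "?n \<le> card \<Z>" using hall[of "{}"] by simp
      obtain D f where D: "D \<subseteq> \<V>\<^sub>0" "inj_on f D" "\<And>v. v \<in> D \<Longrightarrow> f v \<in> r v"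
        "?n \<le> card D + (card \<Z> - ?n)"
      proof (rule hall_deficiency[of "\<V>\<^sub>0" r "card \<Z> - ?n"])
        show "card S \<le> card (\<Union>(r ` S)) + (card \<Z> - ?n)" if "S \<subseteq> \<V>\<^sub>0" for S
          using hall[OF that] le by linarith
      qed (use fin0 in \<open>auto simp: r_def\<close>)
      have f0: "f v \<in> \<V>\<^sub>0" if "v \<in> D" for v using D(3)[OF that] by (simp add: r_def)
      let ?q = "inv_into \<V>\<^sub>0 p"
      have q: "?q (p v) = v" if "v \<in> D" for v using that D(1) p(1) by (auto intro: inv_into_f_f)
      have "card (p ` D) \<le> matching_number F (g ` F) \<U>"
      proof (rule matching_number_ge[OF F(1)])
        show "p ` D \<subseteq> F" using D(1) by (auto simp: F_def)
        show "inj_on (\<lambda>x. g (p (f (?q x)))) (p ` D)"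
        proof (rule inj_onI)
          fix x y assume "x \<in> p ` D" "y \<in> p ` D" and eq: "g (p (f (?q x))) = g (p (f (?q y)))"
          then obtain v w where vw: "v \<in> D" "w \<in> D" "x = p v" "y = p w" by blast
          have "p (f v) = p (f w)"
            using eq vw q f0 inj_onD[OF Aut_inj_on[OF gA F(2)], of "p (f v)" "p (f w)"]
            by (simp add: F_def)
          then have "f v = f w" using inj_onD[OF p(1)] f0 vw by simp
          then have "v = w" using inj_onD[OF D(2)] vw by simp
          then show "x = y" using vw by simp
        qed
        show "(\<lambda>x. g (p (f (?q x)))) ` p ` D \<subseteq> g ` F" using q f0 by (auto simp: F_def)
        fix x assume "x \<in> p ` D"
        then obtain v where v: "v \<in> D" "x = p v" by blast
        then obtain Z a b where Z: "Z \<in> \<Z>" "a \<in> Z" "a \<in> v" "b \<in> f v" "g b \<in> Z"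
          using D(3)[OF v(1)] unfolding r_def by blast
        have "v \<in> \<V>\<^sub>0" using v D(1) by blast
        have "(x, a) \<in> entourage \<U>\<^sub>1"
          using near0[OF \<open>v \<in> \<V>\<^sub>0\<close> _ Z(3), of x] p(2)[OF \<open>v \<in> \<V>\<^sub>0\<close>] v(2) U'(2) by blast
        moreover have "(a, g b) \<in> entourage \<U>\<^sub>1"
        proof -
          have "(a, g b) \<in> entourage \<Z>" using Z unfolding entourage_iff by blast
          then show ?thesis using entourage_mono[OF refined_by_trans[OF ref VZ]] U'(2) by blast
        qed
        moreover have "(g b, g (p (f v))) \<in> entourage \<U>\<^sub>1"
          using U'g[OF g near0[OF f0[OF v(1)] Z(4) p(2)[OF f0[OF v(1)]]]] .
        ultimately have "(x, g (p (f v))) \<in> entourage \<U>" using three by blast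
        then show "(x, g (p (f (?q x)))) \<in> entourage \<U>" using v q by simp
      qed
      moreover have "card (p ` D) = card D" using inj_on_subset[OF p(1) D(1)] by (rule card_image)
      ultimately show ?thesis using D(4) le F(3) Z(3) by linarith
    qed
    then show "\<exists>F. finite F \<and> F \<subseteq> X \<and> card F = uniform_complexity \<D> \<V> \<and>
      (\<forall>g\<in>E. 2 * card F \<le> uniform_complexity \<D> (\<V> \<or>\<^sub>c (`) g ` \<V>) + matching_number F (g ` F) \<U>)"
      using F V0(3) by auto
  qed
qed

end

section \<open>From matchings to coverings\<close>

context perfect_hausdorff_uniformity
begin

text \<open>
  In \<open>isolating_covering\<close>, the set at \<open>x \<in> F\<close> is the only one that contains \<open>x\<close>. It is not chosen small:
  it contains everything near \<open>x\<close> except the rest of \<open>F\<close>, so that it is also a neighbourhood of the points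
  outside \<open>F\<close> that are matched with \<open>x\<close>.
\<close>

definition isolating_set :: "'a set set \<Rightarrow> 'a set \<Rightarrow> 'a \<Rightarrow> 'a set" where
  "isolating_set \<W> F x = entourage \<W> `` {x} - (F - {x})"

definition isolating_covering :: "'a set set \<Rightarrow> 'a set set \<Rightarrow> 'a set \<Rightarrow> 'a set set" where
  "isolating_covering \<U> \<W> F = isolating_set \<W> F ` F \<union> (\<lambda>U. U - F) ` \<U>"

lemma isolating_set_subset: "\<W> \<in> \<D> \<Longrightarrow> isolating_set \<W> F x \<subseteq> X"
  using entourage_subset[of \<W>] unfolding isolating_set_def by blast

text \<open>
  The set \<open>entourage \<W> `` {x}\<close> need not be open; the finer \<open>\<W>'\<close> guarantees that it is a
  neighbourhood of \<open>z\<close> as well.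
\<close>

lemma nbhd_isolating_set:
  assumes W: "\<W>' \<in> \<D>" "entourage \<W>' O entourage \<W>' \<subseteq> entourage \<W>"
    and F: "finite F" "F \<subseteq> X" and xz: "(x, z) \<in> entourage \<W>'" "z \<notin> F - {x}"
  shows "nbhd z (isolating_set \<W> F x)"
proof -
  have z: "z \<in> X" using xz(1) entourage_subset[OF W(1)] by blast
  have "nbhd z (entourage \<W>' `` {z} - (F - {z}))"
    using nbhd_remove_finite[OF F z nbhd_entourage[OF W(1)]] .
  moreover have "entourage \<W>' `` {z} \<subseteq> entourage \<W> `` {x}" using W(2) xz(1) by blast
  then have "entourage \<W>' `` {z} - (F - {z}) \<subseteq> isolating_set \<W> F x"
    using xz(2) unfolding isolating_set_def by blast
  ultimately show ?thesis by (rule nbhd_mono)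
qed

lemma isolating_covering_fin_covs:
  assumes U: "\<U> \<in> fin_covs" and W: "\<W>' \<in> \<D>" "entourage \<W>' O entourage \<W>' \<subseteq> entourage \<W>" "\<W> \<in> \<D>"
    and F: "finite F" "F \<subseteq> X"
  shows "isolating_covering \<U> \<W> F \<in> fin_covs"
  unfolding isolating_covering_def
proof (rule punctured_covering[OF U F(1)])
  fix x assume "x \<in> F"
  then have "(x, x) \<in> entourage \<W>'" using refl_entourage[OF W(1)] F(2) by blast
  then show "nbhd x (isolating_set \<W> F x) \<and> isolating_set \<W> F x \<subseteq> X"
    using nbhd_isolating_set[OF W(1,2) F] isolating_set_subset[OF W(3)] by simp
qed

lemma isolating_covering_refines:
  assumes "\<And>x. x \<in> X \<Longrightarrow> \<exists>U\<in>\<U>. cover_star {x} \<W> \<subseteq> U" "F \<subseteq> X"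
  shows "\<U> \<preceq> isolating_covering \<U> \<W> F"
  unfolding refined_by_def
proof
  fix V assume "V \<in> isolating_covering \<U> \<W> F"
  then consider x where "x \<in> F" "V = isolating_set \<W> F x" | U where "U \<in> \<U>" "V = U - F"
    unfolding isolating_covering_def by blast
  then show "\<exists>U\<in>\<U>. V \<subseteq> U"
  proof cases
    case 1
    then obtain U where "U \<in> \<U>" "cover_star {x} \<W> \<subseteq> U" using assms by blast
    then show ?thesis
      using 1(2) by (intro bexI[of _ U]) (auto simp: isolating_set_def cover_star_singleton)
  qed blast
qed

text \<open>
  In a refinement, members that contain distinct points of \<open>F\<close> are distinct.
\<close>

lemma complexity_isolating_covering_ge:
  assumes V: "isolating_covering \<U> \<W> F \<in> fin_covs" and F: "F \<subseteq> X"
  shows "card F \<le> uniform_complexity \<D> (isolating_covering \<U> \<W> F)"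
proof -
  obtain \<Z> where Z: "\<Z> \<in> fin_covs" "isolating_covering \<U> \<W> F \<preceq> \<Z>"
    "card \<Z> = uniform_complexity \<D> (isolating_covering \<U> \<W> F)"
    using uniform_complexity_attained[OF V] .
  have "\<forall>x\<in>F. \<exists>Z. Z \<in> \<Z> \<and> x \<in> Z"
  proof
    fix x assume "x \<in> F"
    then have "x \<in> X" using F by blast
    then obtain Z where "Z \<in> \<Z>" "x \<in> Z" by (rule member_containing[OF fin_covsD(1)[OF Z(1)]])
    then show "\<exists>Z. Z \<in> \<Z> \<and> x \<in> Z" by blast
  qed
  then obtain z where "\<forall>x\<in>F. z x \<in> \<Z> \<and> x \<in> z x" unfolding bchoice_iff by (rule exE)
  then have z: "z x \<in> \<Z>" "x \<in> z x" if "x \<in> F" for x using that by simp_all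
  have sub: "z x \<inter> F \<subseteq> {x}" if x: "x \<in> F" for x
  proof -
    obtain A where A: "A \<in> isolating_covering \<U> \<W> F" "z x \<subseteq> A" using refined_byD[OF Z(2) z(1)[OF x]] by blast
    have "x \<in> A" using A(2) z(2)[OF x] by blast
    then show ?thesis using A x unfolding isolating_covering_def isolating_set_def by blast
  qed
  have "inj_on z F"
  proof (rule inj_onI)
    fix x y assume "x \<in> F" "y \<in> F" "z x = z y"
    then have "y \<in> z x \<inter> F" using z(2)[of y] by simp
    then show "x = y" using sub[OF \<open>x \<in> F\<close>] by blast
  qed
  then have "card F \<le> card \<Z>" by (rule card_inj_on_le) (use z Z(1) fin_covsD in auto)
  then show ?thesis using Z(3) by simp
qed

text \<open>
  A refinement of the join consists of one neighbourhood for each point of \<open>F \<union> g ` F\<close> and of the members of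
  \<open>\<U> \<or>\<^sub>c g(\<U>)\<close> without these points. Points \<open>x\<close> and \<open>\<psi> x = g y\<close> share the neighbourhood
  \<open>isolating_set \<W> F x \<inter> g ` isolating_set \<W> F y\<close>. It contains both points only because \<open>\<psi> x \<notin> F\<close> and
  \<open>x \<notin> g ` F\<close>, which is why \<open>\<psi>\<close> must stay away from \<open>F \<inter> g ` F\<close>; points of \<open>F \<inter> g ` F\<close>
  are counted once anyway.
\<close>

lemma complexity_join_isolating_covering_le:
  assumes U: "\<U> \<in> fin_covs"
    and W: "\<W>' \<in> \<D>" "entourage \<W>' O entourage \<W>' \<subseteq> entourage \<W>" "\<W> \<in> \<D>"
    and F: "finite F" "F \<subseteq> X" and g: "g \<in> Aut"
    and D: "D \<subseteq> F - g ` F" "inj_on \<psi> D" "\<psi> ` D \<subseteq> g ` F - F"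
    and near: "\<And>x. x \<in> D \<Longrightarrow> (x, \<psi> x) \<in> entourage \<W>'"
      "\<And>x. x \<in> D \<Longrightarrow> (inv_into X g x, inv_into X g (\<psi> x)) \<in> entourage \<W>'"
  defines "\<V> \<equiv> isolating_covering \<U> \<W> F"
  shows "uniform_complexity \<D> (\<V> \<or>\<^sub>c (`) g ` \<V>) + card D + card (F \<inter> g ` F)
    \<le> 2 * card F + card \<U> * card \<U>"
proof -
  let ?S = "isolating_set \<W> F" and ?i = "inv_into X g"
  let ?T = "F \<union> g ` F" and ?J = "\<V> \<or>\<^sub>c (`) g ` \<V>" and ?K = "\<U> \<or>\<^sub>c (`) g ` \<U>"
  note inv = Aut_inv[OF g]
  have gF: "g ` F \<subseteq> X" using inv(1) F(2) by blast
  have V: "\<V> \<in> fin_covs" unfolding \<V>_def using U W F by (rule isolating_covering_fin_covs)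
  have J: "?J \<in> fin_covs" using V image_fin_covs[OF g V] by (rule join_fin_covs)
  have K: "?K \<in> fin_covs" using U image_fin_covs[OF g U] by (rule join_fin_covs)
  define m where "m x = ?S x \<inter> g ` ?S (?i (\<psi> x))" for x
  have m: "m x \<in> ?J" "nbhd x (m x)" "nbhd (\<psi> x) (m x)" if x: "x \<in> D" for x
  proof -
    have xF: "x \<in> F" "x \<notin> g ` F" "\<psi> x \<notin> F" "x \<in> X" using x D F(2) by auto
    obtain y where y: "y \<in> F" "\<psi> x = g y" using x D(3) by blast
    have yX: "y \<in> X" "?i (\<psi> x) = y" using y F(2) inv(4) by auto
    have ix: "?i x \<in> X" "g (?i x) = x" using inv(2,3) xF(4) by auto
    have "?i x \<notin> F" using ix(2) xF(2) by (metis imageI)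
    have 1: "nbhd x (?S x)" "nbhd (\<psi> x) (?S x)"
      using nbhd_isolating_set[OF W(1,2) F] refl_entourage[OF W(1) xF(4)] near(1)[OF x] xF(3)
      by simp_all
    have 2: "nbhd y (?S y)"
      using nbhd_isolating_set[OF W(1,2) F refl_entourage[OF W(1) yX(1)]] by simp
    have "(y, ?i x) \<in> entourage \<W>'" using near(2)[OF x] yX(2) entourage_sym by metis
    then have 3: "nbhd (?i x) (?S y)"
      using nbhd_isolating_set[OF W(1,2) F] \<open>?i x \<notin> F\<close> by blast
    have 4: "nbhd (\<psi> x) (g ` ?S y)"
      using nbhd_image[OF g 2 yX(1) isolating_set_subset[OF W(3)]] y(2) by simp
    have 5: "nbhd x (g ` ?S y)"
      using nbhd_image[OF g 3 ix(1) isolating_set_subset[OF W(3)]] ix(2) by simp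
    show "nbhd x (m x)" "nbhd (\<psi> x) (m x)" using nbhd_Int 1 4 5 yX(2) by (simp_all add: m_def)
    have "?S x \<in> \<V>" "?S y \<in> \<V>" using xF(1) y(1) by (simp_all add: \<V>_def isolating_covering_def)
    then show "m x \<in> ?J" unfolding m_def yX(2) cover_join_def by blast
  qed
  have "\<forall>t\<in>?T. \<exists>A\<in>?J. nbhd t A"
    using nbhd_member[OF fin_covsD(1)[OF J]] F(2) gF by (metis Un_iff subsetD)
  then obtain e where e: "\<And>t. t \<in> ?T \<Longrightarrow> e t \<in> ?J \<and> nbhd t (e t)" by metis
  define c where "c t = (if t \<in> D then m t else if t \<in> \<psi> ` D then m (inv_into D \<psi> t) else e t)" for t
  have c\<psi>: "c (\<psi> x) = c x" "c x = m x" if "x \<in> D" for x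
    using that D by (auto simp: c_def inv_into_f_f)
  have c: "c t \<in> ?J \<and> nbhd t (c t)" if t: "t \<in> ?T" for t
  proof -
    consider "t \<in> D" | x where "x \<in> D" "t = \<psi> x" | "t \<notin> D" "t \<notin> \<psi> ` D" by blast
    then show ?thesis
    proof cases
      case 1
      then show ?thesis using m[OF 1] c\<psi>[OF 1] by simp
    next
      case 2
      then show ?thesis using m[OF 2(1)] c\<psi>[OF 2(1)] by simp
    next
      case 3
      then show ?thesis using e[OF t] by (simp add: c_def)
    qed
  qed
  have finT: "finite ?T" using F(1) by simp
  let ?Z = "c ` ?T \<union> (\<lambda>A. A - ?T) ` ?K"
  have Z: "?Z \<in> fin_covs"
  proof (rule punctured_covering[OF K finT])
    show "nbhd t (c t) \<and> c t \<subseteq> X" if "t \<in> ?T" for t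
      using c[OF that] member_subset[OF fin_covsD(1)[OF J]] by blast
  qed
  have "?J \<preceq> ?Z"
    unfolding refined_by_def
  proof
    fix A assume "A \<in> ?Z"
    then consider t where "t \<in> ?T" "A = c t" | B where "B \<in> ?K" "A = B - ?T" by blast
    then show "\<exists>B\<in>?J. A \<subseteq> B"
    proof cases
      case 1
      then show ?thesis using c[OF 1(1)] by blast
    next
      case 2
      then obtain u u' where u: "u \<in> \<U>" "u' \<in> \<U>" "B = u \<inter> g ` u'" unfolding cover_join_def by blast
      have "u - F \<in> \<V>" "u' - F \<in> \<V>" using u by (auto simp: \<V>_def isolating_covering_def)
      then have "(u - F) \<inter> g ` (u' - F) \<in> ?J" unfolding cover_join_def by blast
      moreover have "A \<subseteq> (u - F) \<inter> g ` (u' - F)" using 2 u by blast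
      ultimately show ?thesis by blast
    qed
  qed
  then have "uniform_complexity \<D> ?J \<le> card ?Z" using Z by (intro uniform_complexity_le)
  also have "\<dots> \<le> card (c ` ?T) + card ((\<lambda>A. A - ?T) ` ?K)" by (rule card_Un_le)
  also have "card ((\<lambda>A. A - ?T) ` ?K) \<le> card ?K"
    using fin_covsD(2)[OF K] by (rule card_image_le)
  also have "card ?K \<le> card \<U> * card ((`) g ` \<U>)"
    using fin_covsD(2)[OF U] by (intro card_cover_join_le) auto
  also have "card ((`) g ` \<U>) \<le> card \<U>" using fin_covsD(2)[OF U] by (rule card_image_le)
  finally have 1: "uniform_complexity \<D> ?J \<le> card (c ` ?T) + card \<U> * card \<U>" by simp
  \<comment> \<open>Matched points share a member of the covering, so the images \<open>\<psi> x\<close> need not be counted.\<close>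
  have "c ` ?T \<subseteq> c ` (?T - \<psi> ` D)"
  proof
    fix A assume "A \<in> c ` ?T"
    then obtain t where t: "t \<in> ?T" "A = c t" by blast
    show "A \<in> c ` (?T - \<psi> ` D)"
    proof (cases "t \<in> \<psi> ` D")
      case True
      then obtain x where x: "x \<in> D" "t = \<psi> x" by blast
      then have "x \<in> ?T - \<psi> ` D" using D by blast
      then show ?thesis using t(2) c\<psi>(1)[OF x(1)] x(2) by blast
    qed (use t in blast)
  qed
  then have "card (c ` ?T) \<le> card (c ` (?T - \<psi> ` D))" using finT by (intro card_mono) auto
  also have "\<dots> \<le> card (?T - \<psi> ` D)" using finT by (intro card_image_le) auto
  also have "\<dots> = card ?T - card D"
  proof -
    have "\<psi> ` D \<subseteq> ?T" using D(3) by blast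
    then show ?thesis
      using card_image[OF D(2)] finite_subset[OF _ finT] by (simp add: card_Diff_subset)
  qed
  finally have 2: "card (c ` ?T) \<le> card ?T - card D" .
  have "card D \<le> card ?T" using D(1) finT by (intro card_mono) auto
  moreover have "card F + card (g ` F) = card ?T + card (F \<inter> g ` F)"
    using F(1) by (intro card_Un_Int) auto
  moreover have "card (g ` F) = card F" using Aut_inj_on[OF g F(2)] by (rule card_image)
  ultimately show ?thesis using 1 2 by linarith
qed

text \<open>
  Replace each \<open>x \<in> F\<close> by \<open>m\<close> points \<open>h (x, i)\<close> near \<open>x\<close>, all of them distinct. If \<open>x\<close> is matched with
  \<open>g y\<close>, then \<open>h (x, i)\<close> can be matched with \<open>g (h (y, i))\<close>.
\<close>

lemma blow_up_matching:
  assumes E: "E \<subseteq> Aut" and F: "finite F" "F \<subseteq> X"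
    and W: "\<W> \<in> \<D>" "entourage \<W> \<subseteq> entourage \<U>"
      "\<And>g x y. g \<in> E \<Longrightarrow> (x, y) \<in> entourage \<W> \<Longrightarrow> (g x, g y) \<in> entourage \<U>"
    and U: "entourage \<U> O entourage \<U> O entourage \<U> \<subseteq> entourage \<U>'"
  obtains F' where "finite F'" "F' \<subseteq> X" "card F' = m * card F"
    "\<And>g. g \<in> E \<Longrightarrow> m * matching_number F (g ` F) \<U> \<le> matching_number F' (g ` F') \<U>'"
proof -
  let ?I = "F \<times> {..<m}"
  have fin: "finite ?I" using F(1) by simp
  have "infinite (entourage \<W> `` {fst p})" if "p \<in> ?I" for p
  proof (rule infinite_nbhd[OF _ nbhd_entourage[OF W(1)]])
    show "fst p \<in> X" using that F(2) by auto
    show "entourage \<W> `` {fst p} \<subseteq> X" using entourage_subset[OF W(1)] by blast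
  qed
  then obtain h where h: "inj_on h ?I" "\<And>p. p \<in> ?I \<Longrightarrow> h p \<in> entourage \<W> `` {fst p}"
    using distinct_representatives_of_infinite_sets[OF fin, of "\<lambda>p. entourage \<W> `` {fst p}"] by blast
  have near: "(x, h (x, i)) \<in> entourage \<W>" if "x \<in> F" "i < m" for x i
    using h(2)[of "(x, i)"] that by simp
  define F' where "F' = h ` ?I"
  show thesis
  proof (rule that[of F'])
    show finF': "finite F'" using fin by (simp add: F'_def)
    show F'X: "F' \<subseteq> X"
      unfolding F'_def using h(2) entourage_subset[OF W(1)] by blast
    show "card F' = m * card F"
      unfolding F'_def card_image[OF h(1)] by (simp add: card_cartesian_product)
    fix g assume gE: "g \<in> E"
    have g: "g \<in> Aut" using E gE by blast
    obtain D \<phi> where D: "D \<subseteq> F" "inj_on \<phi> D" "\<phi> ` D \<subseteq> g ` F" "\<And>x. x \<in> D \<Longrightarrow> (x, \<phi> x) \<in> entourage \<U>"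
      "card D = matching_number F (g ` F) \<U>"
      by (rule matching_number_attained[OF F(1)]) blast
    let ?i = "inv_into X g"
    have i: "?i (\<phi> x) \<in> F" "g (?i (\<phi> x)) = \<phi> x" if x: "x \<in> D" for x
    proof -
      obtain y where "y \<in> F" "\<phi> x = g y" using D(3) x by blast
      moreover from this have "?i (\<phi> x) = y" using Aut_inv(4)[OF g, of y] F(2) by auto
      ultimately show "?i (\<phi> x) \<in> F" "g (?i (\<phi> x)) = \<phi> x" by simp_all
    qed
    define q where "q = (\<lambda>(x, k). h (?i (\<phi> x), k))"
    let ?DI = "D \<times> {..<m}" and ?h = "inv_into ?I h"
    have DI: "?DI \<subseteq> ?I" using D(1) by blast
    have hinv: "?h (h p) = p" if "p \<in> ?DI" for p using h(1) that DI by (auto intro: inv_into_f_f)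
    have qF': "q p \<in> F'" if "p \<in> ?DI" for p using that i(1) by (auto simp: q_def F'_def)
    have q_inj: "inj_on q ?DI"
    proof (rule inj_onI)
      fix p p' assume pp: "p \<in> ?DI" "p' \<in> ?DI" "q p = q p'"
      obtain x k x' k' where x: "p = (x, k)" "p' = (x', k')" by fastforce
      have xD: "x \<in> D" "x' \<in> D" "k < m" "k' < m" using pp x by auto
      have "(?i (\<phi> x), k) = (?i (\<phi> x'), k')"
        by (rule inj_onD[OF h(1)]) (use pp(3) x xD i(1) in \<open>auto simp: q_def\<close>)
      then have "k = k'" "\<phi> x = \<phi> x'" using i(2) xD by (auto, metis)
      then show "p = p'" using inj_onD[OF D(2)] xD x by simp
    qed
    have "card (h ` ?DI) \<le> matching_number F' (g ` F') \<U>'"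
    proof (rule matching_number_ge[OF finF'])
      show "h ` ?DI \<subseteq> F'" using DI by (auto simp: F'_def)
      show "inj_on (\<lambda>x. g (q (?h x))) (h ` ?DI)"
      proof (rule inj_onI)
        fix x y assume "x \<in> h ` ?DI" "y \<in> h ` ?DI" and eq: "g (q (?h x)) = g (q (?h y))"
        then obtain p p' where p: "p \<in> ?DI" "p' \<in> ?DI" "x = h p" "y = h p'" by blast
        have "q p = q p'"
          using eq p hinv inj_onD[OF Aut_inj_on[OF g F'X]] qF' by simp
        then have "p = p'" using inj_onD[OF q_inj] p by blast
        then show "x = y" using p by simp
      qed
      show "(\<lambda>x. g (q (?h x))) ` h ` ?DI \<subseteq> g ` F'" using hinv qF' by auto
      fix x assume "x \<in> h ` ?DI"
      then obtain y k where y: "y \<in> D" "k < m" "x = h (y, k)" by blast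
      have "?h x = (y, k)" using hinv[of "(y, k)"] y by simp
      then have gq: "g (q (?h x)) = g (h (?i (\<phi> y), k))" by (simp add: q_def)
      have "(x, y) \<in> entourage \<U>"
        using entourage_sym[OF near[of y k]] y D(1) W(2) by blast
      moreover have "(y, \<phi> y) \<in> entourage \<U>" using D(4)[OF y(1)] .
      moreover have "(\<phi> y, g (h (?i (\<phi> y), k))) \<in> entourage \<U>"
        using W(3)[OF gE near[OF i(1)[OF y(1)] y(2)]] i(2)[OF y(1)] by simp
      ultimately have "(x, g (h (?i (\<phi> y), k))) \<in> entourage \<U>'" using U by blast
      then show "(x, g (q (?h x))) \<in> entourage \<U>'" using gq by simp
    qed
    moreover have "card (h ` ?DI) = m * card D"
      using card_image[OF inj_on_subset[OF h(1) DI]] by (simp add: card_cartesian_product)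
    ultimately show "m * matching_number F (g ` F) \<U> \<le> matching_number F' (g ` F') \<U>'"
      using D(5) by simp
  qed
qed

text \<open>
  The error term \<open>2 / K\<close> has two equal parts: \<open>1 / K\<close> is the relative loss in \<open>off_diagonal_matching\<close>, and
  the blow-up factor \<open>m\<close> is so large that the \<open>card \<U> * card \<U>\<close> additional members of the covering
  contribute no more than another \<open>1 / K\<close>.
\<close>

lemma covering_from_matchings:
  assumes E: "finite E" "E \<subseteq> Aut" and U: "\<U> \<in> fin_covs" and K: "0 < K"
  shows "\<exists>\<U>'\<in>fin_covs. \<forall>F. finite F \<and> F \<noteq> {} \<and> F \<subseteq> X \<longrightarrow>
    (\<exists>\<V>\<in>fin_covs. \<U> \<preceq> \<V> \<and> (\<forall>g\<in>E.
      real (uniform_complexity \<D> (\<V> \<or>\<^sub>c (`) g ` \<V>)) / real (uniform_complexity \<D> \<V>)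
        \<le> 2 - real (matching_number F (g ` F) \<U>') / real (card F) + 2 / real K))"
proof -
  \<comment> \<open>Working backwards from \<open>\<U>\<close>: \<open>\<W>\<close> and \<open>\<W>\<^sub>1\<close> serve the isolating sets, \<open>\<W>\<^sub>2\<close> controls the inverse automorphisms,
    \<open>\<W>\<^sub>3\<close> allows for the iteration in the off-diagonal matching, and \<open>\<U>'\<close> and \<open>\<W>\<^sub>4\<close> for the blow-up.\<close>
  obtain \<W> where W: "\<W> \<in> fin_covs" "\<And>x. x \<in> X \<Longrightarrow> \<exists>U\<in>\<U>. cover_star {x} \<W> \<subseteq> U"
    using finite_barycentric_refinement[OF U] by blast
  obtain \<W>\<^sub>1 where W1: "\<W>\<^sub>1 \<in> fin_covs" "entourage \<W>\<^sub>1 O entourage \<W>\<^sub>1 \<subseteq> entourage \<W>"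
    using halving_entourage[OF W(1)] .
  have "\<exists>\<W>\<^sub>2\<in>fin_covs. entourage \<W>\<^sub>2 \<subseteq> entourage \<W>\<^sub>1 \<and>
      (\<forall>f\<in>inv_into X ` E. \<forall>x y. (x, y) \<in> entourage \<W>\<^sub>2 \<longrightarrow> (f x, f y) \<in> entourage \<W>\<^sub>1)"
    by (rule equicontinuous_entourage[OF _ _ W1(1)]) (use E Aut_continuous(2) in auto)
  then obtain \<W>\<^sub>2 where W2: "\<W>\<^sub>2 \<in> fin_covs" "entourage \<W>\<^sub>2 \<subseteq> entourage \<W>\<^sub>1"
    and W2g: "\<And>g x y. g \<in> E \<Longrightarrow> (x, y) \<in> entourage \<W>\<^sub>2 \<Longrightarrow> (inv_into X g x, inv_into X g y) \<in> entourage \<W>\<^sub>1"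
    by (elim bexE conjE) simp
  obtain \<W>\<^sub>3 where W3: "\<W>\<^sub>3 \<in> fin_covs" "\<And>k. k \<le> K \<Longrightarrow> entourage \<W>\<^sub>3 ^^ Suc k \<subseteq> entourage \<W>\<^sub>2"
    using iterated_entourage[OF W2(1), of K] by auto
  obtain \<U>' where U': "\<U>' \<in> fin_covs" "\<And>k. k \<le> 2 \<Longrightarrow> entourage \<U>' ^^ Suc k \<subseteq> entourage \<W>\<^sub>3"
    using iterated_entourage[OF W3(1), of 2] by auto
  have "entourage \<U>' ^^ Suc 2 = entourage \<U>' O entourage \<U>' O entourage \<U>'"
    by (simp add: numeral_2_eq_2 O_assoc)
  then have three: "entourage \<U>' O entourage \<U>' O entourage \<U>' \<subseteq> entourage \<W>\<^sub>3" using U'(2)[of 2] by simp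
  have "\<exists>\<W>\<^sub>4\<in>fin_covs. entourage \<W>\<^sub>4 \<subseteq> entourage \<U>' \<and>
      (\<forall>g\<in>E. \<forall>x y. (x, y) \<in> entourage \<W>\<^sub>4 \<longrightarrow> (g x, g y) \<in> entourage \<U>')"
    by (rule equicontinuous_entourage[OF E(1) _ U'(1)]) (use E Aut_continuous(1) in auto)
  then obtain \<W>\<^sub>4 where W4: "\<W>\<^sub>4 \<in> fin_covs" "entourage \<W>\<^sub>4 \<subseteq> entourage \<U>'"
    and W4g: "\<And>g x y. g \<in> E \<Longrightarrow> (x, y) \<in> entourage \<W>\<^sub>4 \<Longrightarrow> (g x, g y) \<in> entourage \<U>'"
    by (elim bexE conjE) simp
  have D: "\<W> \<in> \<D>" "\<W>\<^sub>1 \<in> \<D>" "\<W>\<^sub>3 \<in> \<D>" "\<W>\<^sub>4 \<in> \<D>" using W W1 W3 W4 by (simp_all add: fin_covs_iff)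
  show ?thesis
  proof (rule bexI[OF _ U'(1)], intro allI impI, elim conjE)
    fix F assume F: "finite F" "F \<noteq> {}" "F \<subseteq> X"
    define m where "m = Suc (K * (card \<U> * card \<U>))"
    obtain F' where F': "finite F'" "F' \<subseteq> X" "card F' = m * card F"
      and match: "\<And>g. g \<in> E \<Longrightarrow> m * matching_number F (g ` F) \<U>' \<le> matching_number F' (g ` F') \<W>\<^sub>3"
      by (rule blow_up_matching[OF E(2) F(1,3) D(4) W4(2) _ three, where m = m]) (use W4g in blast)+
    define \<V> where "\<V> = isolating_covering \<U> \<W> F'"
    have V: "\<V> \<in> fin_covs"
      unfolding \<V>_def using U D(2) W1(2) D(1) F'(1,2) by (rule isolating_covering_fin_covs)
    have "\<U> \<preceq> \<V>" unfolding \<V>_def using W(2) F'(2) by (rule isolating_covering_refines)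
    moreover have "real (uniform_complexity \<D> (\<V> \<or>\<^sub>c (`) g ` \<V>)) / real (uniform_complexity \<D> \<V>)
        \<le> 2 - real (matching_number F (g ` F) \<U>') / real (card F) + 2 / real K" if gE: "g \<in> E" for g
    proof -
      have g: "g \<in> Aut" using E gE by blast
      obtain D \<phi> where D\<phi>: "D \<subseteq> F'" "inj_on \<phi> D" "\<phi> ` D \<subseteq> g ` F'"
        "\<And>x. x \<in> D \<Longrightarrow> (x, \<phi> x) \<in> entourage \<W>\<^sub>3" "card D = matching_number F' (g ` F') \<W>\<^sub>3"
        by (rule matching_number_attained[OF F'(1)]) blast
      have refl: "(x, x) \<in> entourage \<W>\<^sub>3" if "x \<in> F'" for x
        using refl_entourage[OF D(3)] F'(2) that by blast
      obtain D' \<psi> where D': "D' \<subseteq> F' - g ` F'" "inj_on \<psi> D'" "\<psi> ` D' \<subseteq> g ` F' - F'"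
        and near: "\<And>x. x \<in> D' \<Longrightarrow> \<exists>k<K. (x, \<psi> x) \<in> entourage \<W>\<^sub>3 ^^ Suc k"
        and cD': "card D \<le> card D' + card (F' \<inter> g ` F') + card F' div K"
        using off_diagonal_matching[OF F'(1) finite_imageI[OF F'(1)] D\<phi>(1-4) refl K] by blast
      have near2: "(x, \<psi> x) \<in> entourage \<W>\<^sub>2" if "x \<in> D'" for x
        using near[OF that] W3(2) by (meson less_imp_le subsetD)
      have "uniform_complexity \<D> (\<V> \<or>\<^sub>c (`) g ` \<V>) + card D' + card (F' \<inter> g ` F')
          \<le> 2 * card F' + card \<U> * card \<U>"
        unfolding \<V>_def
      proof (rule complexity_join_isolating_covering_le[OF U D(2) W1(2) D(1) F'(1,2) g D'])
        fix x assume x: "x \<in> D'"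
        show "(x, \<psi> x) \<in> entourage \<W>\<^sub>1" using near2[OF x] W2(2) by blast
        show "(inv_into X g x, inv_into X g (\<psi> x)) \<in> entourage \<W>\<^sub>1" using W2g[OF gE near2[OF x]] .
      qed
      moreover have "m * matching_number F (g ` F) \<U>' \<le> card D" using match[OF gE] D\<phi>(5) by simp
      ultimately have nat_bound: "uniform_complexity \<D> (\<V> \<or>\<^sub>c (`) g ` \<V>) + m * matching_number F (g ` F) \<U>'
          \<le> 2 * card F' + card \<U> * card \<U> + card F' div K"
        using cD' by linarith
      let ?N = "real (uniform_complexity \<D> (\<V> \<or>\<^sub>c (`) g ` \<V>))" and ?M = "real (matching_number F (g ` F) \<U>')"
        and ?f = "real (card F)" and ?u = "real (card \<U> * card \<U>)" and ?k = "real K"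
      have f: "?f \<ge> 1" using F(1,2) by (simp add: Suc_le_eq card_gt_0_iff)
      have k: "?k > 0" using K by simp
      have rm: "real m = 1 + ?k * ?u" "real m \<ge> 1" by (simp_all add: m_def)
      have mf: "real m * ?f > 0" using rm(2) f by simp
      have "?N + real m * ?M \<le> 2 * (real m * ?f) + ?u + real (card F' div K)"
        using of_nat_mono[OF nat_bound, where 'a = real] F'(3) by simp
      also have "real (card F' div K) \<le> real m * ?f / ?k"
        using of_nat_div_le_of_nat[of "card F'" K, where 'a = real] F'(3) by simp
      also have "?u \<le> real m * ?f / ?k"
      proof -
        have "?u * ?k \<le> real m * 1" using rm(1) by (simp add: mult.commute)
        also have "\<dots> \<le> real m * ?f" using f rm(2) by (intro mult_left_mono) auto
        finally show ?thesis using k by (simp add: pos_le_divide_eq)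
      qed
      finally have "?N \<le> 2 * (real m * ?f) - real m * ?M + 2 * (real m * ?f / ?k)" by simp
      also have "\<dots> = real m * ?f * (2 - ?M / ?f + 2 / ?k)"
        using f by (simp add: right_diff_distrib distrib_left)
      finally have "?N \<le> real m * ?f * (2 - ?M / ?f + 2 / ?k)" .
      then have le: "?N / (real m * ?f) \<le> 2 - ?M / ?f + 2 / ?k"
        using mf by (simp add: pos_divide_le_eq mult.commute)
      have "real m * ?f \<le> real (uniform_complexity \<D> \<V>)"
        using complexity_isolating_covering_ge[OF V[unfolded \<V>_def] F'(2)] F'(3)
        by (metis \<V>_def of_nat_le_iff of_nat_mult)
      then have "?N / real (uniform_complexity \<D> \<V>) \<le> ?N / (real m * ?f)"
        using mf by (intro divide_left_mono) auto
      then show ?thesis using le by linarith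
    qed
    ultimately show "\<exists>\<V>\<in>fin_covs. \<U> \<preceq> \<V> \<and> (\<forall>g\<in>E.
      real (uniform_complexity \<D> (\<V> \<or>\<^sub>c (`) g ` \<V>)) / real (uniform_complexity \<D> \<V>)
        \<le> 2 - real (matching_number F (g ` F) \<U>') / real (card F) + 2 / real K)"
      using V by blast
  qed
qed

end

section \<open>The equality\<close>

theorem theorem6p7:
  fixes X :: "'a set" and \<D> :: "'a set set set" and G :: "('a \<Rightarrow> 'a) set"
  assumes "covering_uniform_space X \<D>"
    and "Hausdorff_space (uniform_topology X \<D>)"
    and "no_isolated_points (uniform_topology X \<D>)"
    and "subgroup G (uniform_Aut X \<D>)"
  shows "asymptotic_uniform_complexity \<D> G = 2 - mean_matching_number X \<D> G"
proof -
  interpret perfect_hausdorff_uniformity X \<D>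
    using assms(1-3) by unfold_locales
  have GA: "G \<subseteq> Aut" using assms(4) by (rule subgroup.subset)
  obtain e where e: "e \<in> G" using subgroup.one_closed[OF assms(4)] by blast
  obtain \<U>\<^sub>0 where U0: "\<U>\<^sub>0 \<in> fin_covs"
  proof -
    obtain \<U> where "\<U> \<in> \<D>" using uniformity unfolding uniformity_on_def by blast
    then have "{X} \<in> \<D>"
      by (rule uniform_coveringI) (use member_subset \<open>\<U> \<in> \<D>\<close> in auto)
    then show thesis by (intro that[of "{X}"] fin_covsI) simp_all
  qed
  define \<mu> where "\<mu> = mean_matching_number X \<D> G"
  define \<omega> where "\<omega> = asymptotic_uniform_complexity \<D> G"
  let ?c = "\<lambda>\<V> g. ereal (real (uniform_complexity \<D> (\<V> \<or>\<^sub>c (`) g ` \<V>)) / real (uniform_complexity \<D> \<V>))"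
  let ?R = "\<lambda>\<U>. {\<V> \<in> fin_covs. \<U> \<preceq> \<V>}"
  let ?m = "\<lambda>\<U> F g. ereal (real (matching_number F (g ` F) \<U>) / real (card F))"
  have \<omega>_def': "\<omega> = (SUP E\<in>Fpow G. SUP \<U>\<in>fin_covs. INF \<V>\<in>?R \<U>. SUP g\<in>E. ?c \<V> g)"
    by (simp add: \<omega>_def asymptotic_uniform_complexity_def)
  have \<mu>_def': "\<mu> = (INF E\<in>Fpow G. INF \<U>\<in>fin_covs. SUP F\<in>Fpow X - {{}}. INF g\<in>E. ?m \<U> F g)"
    by (simp add: \<mu>_def mean_matching_number_def)
  have m_le_1: "?m \<U> F g \<le> 1" if "F \<in> Fpow X - {{}}" for \<U> F g
  proof -
    have F: "finite F" using that by (simp add: Fpow_def)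
    obtain D \<phi> where "D \<subseteq> F" "card D = matching_number F (g ` F) \<U>"
      by (rule matching_number_attained[OF F]) blast
    then have "matching_number F (g ` F) \<U> \<le> card F" using card_mono[OF F] by metis
    then have "real (matching_number F (g ` F) \<U>) / real (card F) \<le> 1"
      by (cases "card F = 0") (simp_all add: divide_le_eq)
    then show "?m \<U> F g \<le> 1" by (simp add: one_ereal_def)
  qed
  \<comment> \<open>For \<open>E = {}\<close> the inner infima and suprema are infinite; the set \<open>{e}\<close> makes \<open>\<mu>\<close> and \<open>\<omega>\<close> real numbers.\<close>
  have eF: "{e} \<in> Fpow G" using e by (simp add: Fpow_def)
  obtain x where x: "x \<in> X" using X_nonempty by blast
  have \<mu>_ge: "0 \<le> \<mu>"
    unfolding \<mu>_def'
  proof (intro INF_greatest)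
    fix E \<U>
    have "{x} \<in> Fpow X - {{}}" using x by (simp add: Fpow_def)
    then have "(INF g\<in>E. ?m \<U> {x} g) \<le> (SUP F\<in>Fpow X - {{}}. INF g\<in>E. ?m \<U> F g)" by (rule SUP_upper)
    moreover have "0 \<le> (INF g\<in>E. ?m \<U> {x} g)" by (rule INF_greatest) simp
    ultimately show "0 \<le> (SUP F\<in>Fpow X - {{}}. INF g\<in>E. ?m \<U> F g)" by (rule order_trans[rotated])
  qed
  have \<mu>_le: "\<mu> \<le> 1"
  proof -
    have "\<mu> \<le> (SUP F\<in>Fpow X - {{}}. INF g\<in>{e}. ?m \<U>\<^sub>0 F g)"
      unfolding \<mu>_def' by (rule INF_lower2[OF eF], rule INF_lower2[OF U0], rule order_refl)
    also have "\<dots> \<le> 1" by (rule SUP_least) (rule INF_lower2[of e], simp, erule m_le_1)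
    finally show ?thesis .
  qed
  obtain r where r: "\<mu> = ereal r" using \<mu>_ge \<mu>_le by (cases \<mu>) auto
  have upper: "\<omega> \<le> ereal (2 - r)"
    unfolding \<omega>_def'
  proof (intro SUP_least)
    fix E \<U> assume E: "E \<in> Fpow G" and U: "\<U> \<in> fin_covs"
    have finE: "finite E" "E \<subseteq> Aut" using E GA by (auto simp: Fpow_def)
    show "(INF \<V>\<in>?R \<U>. SUP g\<in>E. ?c \<V> g) \<le> ereal (2 - r)"
    proof (rule ereal_le_epsilon2)
      fix \<epsilon> :: real assume \<epsilon>: "0 < \<epsilon>"
      obtain K where K: "4 / \<epsilon> < real K" using reals_Archimedean2 by blast
      then have K0: "0 < K" using \<epsilon> by (metis divide_pos_pos less_trans of_nat_0_less_iff zero_less_numeral)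
      have K2: "2 / real K < \<epsilon> / 2" using K K0 \<epsilon> by (simp add: field_simps)
      obtain \<U>' where U': "\<U>' \<in> fin_covs"
        and cov: "\<And>F. finite F \<and> F \<noteq> {} \<and> F \<subseteq> X \<Longrightarrow> \<exists>\<V>\<in>fin_covs. \<U> \<preceq> \<V> \<and> (\<forall>g\<in>E.
          real (uniform_complexity \<D> (\<V> \<or>\<^sub>c (`) g ` \<V>)) / real (uniform_complexity \<D> \<V>)
          \<le> 2 - real (matching_number F (g ` F) \<U>') / real (card F) + 2 / real K)"
        using covering_from_matchings[OF finE U K0] by blast
      have "\<mu> \<le> (SUP F\<in>Fpow X - {{}}. INF g\<in>E. ?m \<U>' F g)"
        unfolding \<mu>_def' by (rule INF_lower2[OF E], rule INF_lower2[OF U'], rule order_refl)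
      then have "ereal (r - \<epsilon> / 2) < (SUP F\<in>Fpow X - {{}}. INF g\<in>E. ?m \<U>' F g)"
        using r \<epsilon> by (auto intro: less_le_trans[of _ "ereal r"])
      then obtain F where F: "F \<in> Fpow X - {{}}" "ereal (r - \<epsilon> / 2) < (INF g\<in>E. ?m \<U>' F g)"
        unfolding less_SUP_iff by blast
      have Fr: "r - \<epsilon> / 2 < real (matching_number F (g ` F) \<U>') / real (card F)" if "g \<in> E" for g
        using less_INF_D[OF F(2) that] by simp
      obtain \<V> where V: "\<V> \<in> fin_covs" "\<U> \<preceq> \<V>" and bound: "\<And>g. g \<in> E \<Longrightarrow>
          real (uniform_complexity \<D> (\<V> \<or>\<^sub>c (`) g ` \<V>)) / real (uniform_complexity \<D> \<V>)
          \<le> 2 - real (matching_number F (g ` F) \<U>') / real (card F) + 2 / real K"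
        using cov[of F] F(1) unfolding Fpow_def by blast
      have "(INF \<V>\<in>?R \<U>. SUP g\<in>E. ?c \<V> g) \<le> (SUP g\<in>E. ?c \<V> g)"
        using V by (intro INF_lower) simp
      also have "\<dots> \<le> ereal (2 - r + \<epsilon>)"
      proof (rule SUP_least)
        fix g assume g: "g \<in> E"
        show "?c \<V> g \<le> ereal (2 - r + \<epsilon>)"
          unfolding ereal_less_eq using bound[OF g] Fr[OF g] K2 by linarith
      qed
      finally show "(INF \<V>\<in>?R \<U>. SUP g\<in>E. ?c \<V> g) \<le> ereal (2 - r) + ereal \<epsilon>" by simp
    qed
  qed
  have "0 \<le> \<omega>"
  proof -
    have "0 \<le> (INF \<V>\<in>?R \<U>\<^sub>0. SUP g\<in>{e}. ?c \<V> g)" by (rule INF_greatest) simp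
    also have "\<dots> \<le> \<omega>"
      unfolding \<omega>_def' by (rule SUP_upper2[OF eF], rule SUP_upper2[OF U0], rule order_refl)
    finally show ?thesis .
  qed
  then obtain s where s: "\<omega> = ereal s" using upper by (cases \<omega>) auto
  have "ereal (2 - s) \<le> \<mu>"
    unfolding \<mu>_def'
  proof (intro INF_greatest)
    fix E \<U> assume E: "E \<in> Fpow G" and U: "\<U> \<in> fin_covs"
    have finE: "finite E" "E \<subseteq> Aut" using E GA by (auto simp: Fpow_def)
    show "ereal (2 - s) \<le> (SUP F\<in>Fpow X - {{}}. INF g\<in>E. ?m \<U> F g)"
    proof (rule ereal_le_epsilon2)
      fix \<epsilon> :: real assume \<epsilon>: "0 < \<epsilon>"
      obtain \<U>' where U': "\<U>' \<in> fin_covs" and mat: "\<And>\<V>. \<V> \<in> fin_covs \<Longrightarrow> \<U>' \<preceq> \<V> \<Longrightarrow>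
        \<exists>F. finite F \<and> F \<subseteq> X \<and> card F = uniform_complexity \<D> \<V> \<and>
        (\<forall>g\<in>E. 2 * card F \<le> uniform_complexity \<D> (\<V> \<or>\<^sub>c (`) g ` \<V>) + matching_number F (g ` F) \<U>)"
        using matching_from_coverings[OF finE U] by blast
      have "(INF \<V>\<in>?R \<U>'. SUP g\<in>E. ?c \<V> g) \<le> \<omega>"
        unfolding \<omega>_def' by (rule SUP_upper2[OF E], rule SUP_upper2[OF U'], rule order_refl)
      then have "(INF \<V>\<in>?R \<U>'. SUP g\<in>E. ?c \<V> g) < ereal (s + \<epsilon>)"
        using s \<epsilon> by (auto intro: le_less_trans[of _ "ereal s"])
      then obtain \<V> where V: "\<V> \<in> ?R \<U>'" "(SUP g\<in>E. ?c \<V> g) < ereal (s + \<epsilon>)"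
        unfolding INF_less_iff by blast
      then obtain F where F: "finite F" "F \<subseteq> X" "card F = uniform_complexity \<D> \<V>"
        and match: "\<And>g. g \<in> E \<Longrightarrow>
          2 * card F \<le> uniform_complexity \<D> (\<V> \<or>\<^sub>c (`) g ` \<V>) + matching_number F (g ` F) \<U>"
        using mat[of \<V>] by blast
      have pos: "0 < card F" using F(3) uniform_complexity_pos[of \<V>] V(1) by simp
      then have FF: "F \<in> Fpow X - {{}}" using F by (auto simp: Fpow_def)
      have "ereal (2 - s - \<epsilon>) \<le> (INF g\<in>E. ?m \<U> F g)"
      proof (rule INF_greatest)
        fix g assume g: "g \<in> E"
        let ?N = "real (uniform_complexity \<D> (\<V> \<or>\<^sub>c (`) g ` \<V>))" and ?M = "real (matching_number F (g ` F) \<U>)"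
        have "?c \<V> g < ereal (s + \<epsilon>)" using SUP_lessD[OF V(2) g] .
        then have "?N / real (card F) < s + \<epsilon>" using F(3) by simp
        moreover have "2 \<le> (?N + ?M) / real (card F)"
          using of_nat_mono[OF match[OF g], where 'a = real] pos by (simp add: pos_le_divide_eq)
        ultimately have "2 - s - \<epsilon> \<le> ?M / real (card F)" by (simp add: add_divide_distrib)
        then show "ereal (2 - s - \<epsilon>) \<le> ?m \<U> F g" by simp
      qed
      also have "\<dots> \<le> (SUP F\<in>Fpow X - {{}}. INF g\<in>E. ?m \<U> F g)" using FF by (rule SUP_upper)
      finally show "ereal (2 - s) \<le> (SUP F\<in>Fpow X - {{}}. INF g\<in>E. ?m \<U> F g) + ereal \<epsilon>"
        by (cases "SUP F\<in>Fpow X - {{}}. INF g\<in>E. ?m \<U> F g") auto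
    qed
  qed
  then have "s = 2 - r" using r s upper by simp
  then have "\<omega> = 2 - \<mu>" using r s by (simp flip: ereal_minus(1) numeral_eq_ereal)
  then show ?thesis by (simp only: \<omega>_def \<mu>_def)
qed

end
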